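(* Let $A_1,A_2$ be two commuting bounded operators on a Hilbert space $E$ which satisfy $[A_1^*,A_1]=[A_2^*,A_2]$ and $\omega(A_1+A_2z)\le1$ for all $z\in\mathbb T$. Then $A_1,A_2$ are the fundamental operators of an $\mathbb E$-contraction on $H^2(E)$; that is, there is an $\mathbb E$-contraction $(T_1,T_2,T_3)$ on $H^2(E)$ such that, under a unitary identification of $\mathcal D_{T_3}$ with $E$, the fundamental operators of $(T_1,T_2,T_3)$ are $A_1,A_2$.
   Context: The tetrablock is $\mathbb E=\{(x_1,x_2,x_3)\in\mathbb C^3: 1-zx_1-wx_2+zwx_3\ne0 \text{ whenever } |z|\le1,|w|\le1\}$. A commuting triple $(T_1,T_2,T_3)$ of bounded Hilbert space operators is an $\mathbb E$-contraction if its Taylor joint spectrum lies in $\overline{\mathbb E}$ and $\|p(T_1,T_2,T_3)\|\le\sup_{\overline{\mathbb E}}|p|$ for every polynomial $p$ in three variables. For a contraction $T$, $D_T=(I-T^*T)^{1/2}$ and $\mathcal D_T=\overline{\mathrm{Ran}}\,D_T$. The fundamental operators of an $\mathbb E$-contraction $(T_1,T_2,T_3)$ are the unique bounded operators $A_1,A_2$ on $\mathcal D_{T_3}$ with $T_1-T_2^*T_3=D_{T_3}A_1D_{T_3}$ and $T_2-T_1^*T_3=D_{T_3}A_2D_{T_3}$ (they are known to exist). $H^2(E)$ is the Hardy space of $E$-valued functions on the unit disc, $\mathbb T$ is the unit circle, $\omega(\cdot)$ is the numerical radius and $[S_1,S_2]=S_1S_2-S_2S_1$. *)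

theory Defs
  imports "HOL-Analysis.Analysis" "HOL-Library.Poly_Mapping"
begin

section \<open>Complex Hilbert spaces\<close>

text \<open>The complex inner product is linear in its first argument; its real part is the
  real inner product of the library, so norm and topology are the library ones.\<close>

class complex_inner = real_inner +
  fixes scaleC :: "complex \<Rightarrow> 'a \<Rightarrow> 'a" (infixr \<open>*\<^sub>C\<close> 75)
    and cinner :: "'a \<Rightarrow> 'a \<Rightarrow> complex"
  assumes scaleC_add_right: "c *\<^sub>C (x + y) = c *\<^sub>C x + c *\<^sub>C y"
    and scaleC_add_left: "(c + d) *\<^sub>C x = c *\<^sub>C x + d *\<^sub>C x"
    and scaleC_scaleC: "c *\<^sub>C d *\<^sub>C x = (c * d) *\<^sub>C x"
    and scaleR_scaleC: "r *\<^sub>R x = complex_of_real r *\<^sub>C x"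
    and cinner_commute: "cinner x y = cnj (cinner y x)"
    and cinner_add_left: "cinner (x + y) z = cinner x z + cinner y z"
    and cinner_scaleC_left: "cinner (c *\<^sub>C x) y = c * cinner x y"
    and inner_eq_Re_cinner: "inner x y = Re (cinner x y)"

class chilbert_space = complex_inner + complete_space

instance chilbert_space \<subseteq> banach ..

lemma cinner_add_right: "cinner x (y + z) = cinner x y + cinner x z"
  by (metis cinner_add_left cinner_commute complex_cnj_add)

lemma cinner_scaleC_right: "cinner x (c *\<^sub>C y) = cnj c * cinner x y"
  by (metis cinner_commute cinner_scaleC_left complex_cnj_mult)

lemma cinner_scaleR_left: "cinner (r *\<^sub>R x) y = r *\<^sub>R cinner x y"
  by (simp add: scaleR_scaleC cinner_scaleC_left scaleR_conv_of_real)

lemma cinner_scaleR_right: "cinner x (r *\<^sub>R y) = r *\<^sub>R cinner x y"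
  by (simp add: scaleR_scaleC cinner_scaleC_right scaleR_conv_of_real)

lemma cinner_self: "cinner x x = complex_of_real ((norm x)\<^sup>2)"
proof -
  have "Im (cinner x x) = 0"
    using cinner_commute[of x x] by (metis Im_complex_of_real complex_cnj_cancel_iff 
        Reals_cnj_iff complex_is_Real_iff)
  moreover have "Re (cinner x x) = (norm x)\<^sup>2"
    by (metis inner_eq_Re_cinner power2_norm_eq_inner)
  ultimately show ?thesis by (simp add: complex_eq_iff)
qed

lemma norm_scaleC: "norm (c *\<^sub>C x) = cmod c * norm x"
proof -
  have "cinner (c *\<^sub>C x) (c *\<^sub>C x) = (c * cnj c) * cinner x x"
    by (simp add: cinner_scaleC_left cinner_scaleC_right)
  then have "complex_of_real ((norm (c *\<^sub>C x))\<^sup>2) = complex_of_real ((cmod c * norm x)\<^sup>2)"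
    unfolding cinner_self by (simp add: complex_norm_square[symmetric] power_mult_distrib)
  then have "(norm (c *\<^sub>C x))\<^sup>2 = (cmod c * norm x)\<^sup>2"
    by (simp only: of_real_eq_iff)
  then show ?thesis by (simp add: power2_eq_iff_nonneg)
qed

lemma norm_cinner_le: "cmod (cinner x y) \<le> norm x * norm y"
proof (cases "cinner x y = 0")
  case False
  define c where "c = cnj (sgn (cinner x y))"
  have c: "cmod c = 1" using False by (simp add: c_def norm_sgn)
  have "cinner (c *\<^sub>C x) y = complex_of_real (cmod (cinner x y))"
    using False complex_norm_square[of "cinner x y"]
    by (simp add: c_def cinner_scaleC_left sgn_div_norm scaleR_conv_of_real field_simps
        power2_eq_square)
  then have "cmod (cinner x y) = inner (c *\<^sub>C x) y" by (simp add: inner_eq_Re_cinner)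
  also have "\<dots> \<le> norm (c *\<^sub>C x) * norm y" by (rule norm_cauchy_schwarz)
  finally show ?thesis by (simp add: norm_scaleC c)
qed simp

lemma bounded_linear_cinner_left: "bounded_linear (\<lambda>x. cinner x y)"
  by (rule bounded_linear_intro[where K = "norm y"])
     (simp_all add: cinner_add_left cinner_scaleR_left norm_cinner_le)

lemma bounded_linear_scaleC: "bounded_linear (\<lambda>x. c *\<^sub>C x)"
  by (rule bounded_linear_intro[where K = "cmod c"])
     (simp_all add: scaleC_add_right scaleR_scaleC scaleC_scaleC norm_scaleC mult.commute)

section \<open>The vector-valued Hardy space\<close>

definition square_summable :: "(nat \<Rightarrow> 'e::chilbert_space) \<Rightarrow> bool" where
  "square_summable a \<longleftrightarrow> summable (\<lambda>n. (norm (a n))\<^sup>2)"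

text \<open>Functions on the open unit disc are total functions that vanish off the disc.\<close>

definition disc_series :: "(nat \<Rightarrow> 'e::chilbert_space) \<Rightarrow> complex \<Rightarrow> 'e" where
  "disc_series a z = (if cmod z < 1 then suminf (\<lambda>n. z ^ n *\<^sub>C a n) else 0)"

typedef (overloaded) 'e hardy = "{f. \<exists>a::nat \<Rightarrow> 'e::chilbert_space. square_summable a \<and> f = disc_series a}"
  morphisms hardy_fun Abs_hardy
proof
  show "disc_series (\<lambda>n. 0) \<in> {f. \<exists>a::nat \<Rightarrow> 'e. square_summable a \<and> f = disc_series a}"
    by (auto intro!: exI[of _ "\<lambda>n. 0"] simp: square_summable_def)
qed

text \<open>Taylor coefficients; they are unique by \<open>disc_series_inject\<close> below.\<close>

definition hardy_coeff :: "'e::chilbert_space hardy \<Rightarrow> nat \<Rightarrow> 'e" where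
  "hardy_coeff f = (THE a. square_summable a \<and> hardy_fun f = disc_series a)"

lemma disc_series_sums:
  fixes a :: "nat \<Rightarrow> 'e::chilbert_space"
  assumes a: "square_summable a" and z: "cmod z < 1"
  shows "(\<lambda>n. z ^ n *\<^sub>C a n) sums disc_series a z"
proof -
  have "(\<lambda>n. (norm (a n))\<^sup>2) \<longlonglongrightarrow> 0"
    using a unfolding square_summable_def by (rule summable_LIMSEQ_zero)
  then have "Bseq (\<lambda>n. (norm (a n))\<^sup>2)"
    using convergentI convergent_imp_Bseq by blast
  then obtain K where K: "\<And>n. (norm (a n))\<^sup>2 \<le> K"
    by (auto simp: Bseq_def)
  have le: "norm (a n) \<le> sqrt K" for n
    using K by (simp add: real_le_rsqrt)
  have "summable (\<lambda>n. sqrt K * cmod z ^ n)"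
    using z by (intro summable_mult summable_geometric) simp
  moreover have "norm (z ^ n *\<^sub>C a n) \<le> sqrt K * cmod z ^ n" for n
    using mult_left_mono[OF le[of n], of "cmod z ^ n"]
    by (simp add: norm_scaleC norm_power mult.commute)
  ultimately have "summable (\<lambda>n. z ^ n *\<^sub>C a n)"
    by (rule summable_comparison_test'[where N = 0])
  then show ?thesis using z by (simp add: disc_series_def summable_sums)
qed

lemma powser_zero_coeffs:
  fixes c :: "nat \<Rightarrow> complex"
  assumes "\<And>z. cmod z < 1 \<Longrightarrow> (\<lambda>n. c n * z ^ n) sums 0"
  shows "c n = 0"
proof (induction n rule: less_induct)
  case (less n)
  have "(\<lambda>m. c (m + n) * z ^ m) sums 0" if "z \<noteq> 0" "cmod z < 1" for z
  proof -
    have "(\<lambda>m. c (m + n) * z ^ (m + n)) sums (0 - (\<Sum>i<n. c i * z ^ i))"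
      by (rule sums_split_initial_segment[OF assms[OF that(2)]])
    then have "(\<lambda>m. c (m + n) * z ^ (m + n)) sums 0" using less by simp
    then have "(\<lambda>m. (c (m + n) * z ^ (m + n)) / z ^ n) sums (0 / z ^ n)"
      by (rule sums_divide)
    then show ?thesis using that by (simp add: power_add)
  qed
  then have "((\<lambda>z::complex. 0::complex) \<longlongrightarrow> c (0 + n)) (at 0)"
    by (intro powser_limit_0_strong[where s = 1]) auto
  then show ?case by (simp add: tendsto_const_iff)
qed

lemma disc_series_inject:
  fixes a b :: "nat \<Rightarrow> 'e::chilbert_space"
  assumes "square_summable a" "square_summable b" "disc_series a = disc_series b"
  shows "a = b"
proof
  fix n
  have "cinner (a n) y - cinner (b n) y = 0" for y
  proof (rule powser_zero_coeffs[where c = "\<lambda>n. cinner (a n) y - cinner (b n) y"])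
    fix z :: complex assume z: "cmod z < 1"
    note L = bounded_linear.sums[OF bounded_linear_cinner_left[of y]]
    from sums_diff[OF L[OF disc_series_sums[OF assms(1) z]] L[OF disc_series_sums[OF assms(2) z]]]
    show "(\<lambda>n. (cinner (a n) y - cinner (b n) y) * z ^ n) sums 0"
      by (simp add: assms(3) cinner_scaleC_left algebra_simps)
  qed
  then have "inner (a n) y = inner (b n) y" for y by (simp add: inner_eq_Re_cinner)
  then have "inner (a n - b n) (a n - b n) = 0" by (simp add: inner_diff_left)
  then show "a n = b n" by simp
qed

lemma hardy_coeff:
  "square_summable (hardy_coeff f)" "hardy_fun f = disc_series (hardy_coeff f)"
proof -
  obtain a where a: "square_summable a \<and> hardy_fun f = disc_series a"
    using hardy_fun[of f] by auto
  have "square_summable (hardy_coeff f) \<and> hardy_fun f = disc_series (hardy_coeff f)"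
    unfolding hardy_coeff_def
    by (rule theI[where a = a]) (use a disc_series_inject in metis)+
  then show "square_summable (hardy_coeff f)" "hardy_fun f = disc_series (hardy_coeff f)"
    by auto
qed

lemma hardy_coeff_Abs:
  assumes "square_summable a" "F = disc_series a"
  shows "hardy_coeff (Abs_hardy F) = a"
  using hardy_coeff[of "Abs_hardy F"] assms
  by (metis (mono_tags, lifting) Abs_hardy_inverse disc_series_inject mem_Collect_eq)

lemma hardy_eqI: "(\<And>n. hardy_coeff f n = hardy_coeff g n) \<Longrightarrow> f = g"
  by (metis ext hardy_coeff(2) hardy_fun_inject)

lemma square_summable_zero: "square_summable (\<lambda>n. 0)"
  by (simp add: square_summable_def)

lemma square_summable_add:
  assumes "square_summable a" "square_summable b"
  shows "square_summable (\<lambda>n. a n + b n)"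
  unfolding square_summable_def
proof (rule summable_comparison_test')
  show "summable (\<lambda>n. 2 * (norm (a n))\<^sup>2 + 2 * (norm (b n))\<^sup>2)"
    using assms by (auto simp: square_summable_def intro!: summable_add summable_mult)
  have "(norm (a n + b n))\<^sup>2 \<le> (norm (a n) + norm (b n))\<^sup>2" for n
    by (simp add: norm_triangle_ineq power_mono)
  moreover have "(norm (a n) + norm (b n))\<^sup>2 \<le> 2 * (norm (a n))\<^sup>2 + 2 * (norm (b n))\<^sup>2" for n
    using zero_le_power2[of "norm (a n) - norm (b n)"]
    by (simp add: power2_eq_square algebra_simps)
  ultimately show "norm ((norm (a n + b n))\<^sup>2) \<le> 2 * (norm (a n))\<^sup>2 + 2 * (norm (b n))\<^sup>2"
    if "n \<ge> 0" for n
    by (smt (verit) real_norm_def zero_le_power2)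
qed

lemma square_summable_scaleC:
  "square_summable a \<Longrightarrow> square_summable (\<lambda>n. c *\<^sub>C a n)"
  by (simp add: square_summable_def norm_scaleC power_mult_distrib summable_mult)

lemma summable_cinner:
  assumes "square_summable a" "square_summable b"
  shows "summable (\<lambda>n. cinner (a n) (b n))"
proof (rule summable_comparison_test')
  show "summable (\<lambda>n. (norm (a n))\<^sup>2 + (norm (b n))\<^sup>2)"
    using assms by (auto simp: square_summable_def intro!: summable_add)
  show "cmod (cinner (a n) (b n)) \<le> (norm (a n))\<^sup>2 + (norm (b n))\<^sup>2" if "n \<ge> 0" for n
  proof -
    have "0 \<le> norm (a n) * norm (b n)" by simp
    moreover have "2 * (norm (a n) * norm (b n)) \<le> (norm (a n))\<^sup>2 + (norm (b n))\<^sup>2"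
      using zero_le_power2[of "norm (a n) - norm (b n)"]
      by (simp add: power2_eq_square algebra_simps)
    ultimately show ?thesis using norm_cinner_le[of "a n" "b n"] by linarith
  qed
qed

lemma disc_series_add:
  assumes "square_summable a" "square_summable b"
  shows "disc_series a z + disc_series b z = disc_series (\<lambda>n. a n + b n) z"
proof (cases "cmod z < 1")
  case True
  from sums_add[OF disc_series_sums[OF assms(1) True] disc_series_sums[OF assms(2) True]]
    disc_series_sums[OF square_summable_add[OF assms] True]
  show ?thesis by (simp add: scaleC_add_right sums_unique2)
qed (simp add: disc_series_def)

lemma scaleC_zero_right: "c *\<^sub>C 0 = 0"
  by (metis add_cancel_right_right scaleC_add_right)

lemma scaleC_one: "1 *\<^sub>C x = x"
  using scaleR_scaleC[of 1 x] by simp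

lemma disc_series_scaleC:
  assumes "square_summable a"
  shows "c *\<^sub>C disc_series a z = disc_series (\<lambda>n. c *\<^sub>C a n) z"
proof (cases "cmod z < 1")
  case True
  from bounded_linear.sums[OF bounded_linear_scaleC[of c] disc_series_sums[OF assms True]]
    disc_series_sums[OF square_summable_scaleC[OF assms, of c] True]
  show ?thesis by (auto simp: scaleC_scaleC mult.commute intro: sums_unique2)
qed (simp add: disc_series_def scaleC_zero_right)

instantiation hardy :: (chilbert_space) complex_inner
begin

definition "0 = Abs_hardy (\<lambda>z. 0)"
definition "f + g = Abs_hardy (\<lambda>z. hardy_fun f z + hardy_fun g z)"
definition "c *\<^sub>C f = Abs_hardy (\<lambda>z. c *\<^sub>C hardy_fun f z)"
definition "- f = (-1) *\<^sub>C (f :: 'a hardy)"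
definition "f - g = f + - (g :: 'a hardy)"
definition "r *\<^sub>R f = complex_of_real r *\<^sub>C (f :: 'a hardy)"
definition "cinner f g = suminf (\<lambda>n. cinner (hardy_coeff f n) (hardy_coeff g n))"
definition "inner f g = Re (cinner f (g :: 'a hardy))"
definition "norm f = sqrt (inner f (f :: 'a hardy))"
definition "dist f g = norm (f - (g :: 'a hardy))"
definition "sgn f = inverse (norm f) *\<^sub>R (f :: 'a hardy)"
definition [code del]:
  "(uniformity :: ('a hardy \<times> 'a hardy) filter) = (INF e\<in>{0 <..}. principal {(x, y). dist x y < e})"
definition [code del]:
  "open (U :: 'a hardy set) \<longleftrightarrow> (\<forall>x\<in>U. \<forall>\<^sub>F (x', y) in uniformity. x' = x \<longrightarrow> y \<in> U)"

lemma hardy_coeff_zero: "hardy_coeff (0 :: 'a hardy) n = 0"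
proof -
  have "(\<lambda>z. 0 :: 'a) = disc_series (\<lambda>n. 0)"
    by (auto simp: disc_series_def scaleC_zero_right)
  then show ?thesis
    unfolding zero_hardy_def by (simp add: hardy_coeff_Abs[OF square_summable_zero])
qed

lemma hardy_coeff_add: "hardy_coeff (f + g :: 'a hardy) n = hardy_coeff f n + hardy_coeff g n"
  unfolding plus_hardy_def
  by (subst hardy_coeff_Abs[OF square_summable_add[OF hardy_coeff(1)[of f] hardy_coeff(1)[of g]]])
     (auto simp: hardy_coeff disc_series_add)

lemma hardy_coeff_scaleC: "hardy_coeff (c *\<^sub>C f :: 'a hardy) n = c *\<^sub>C hardy_coeff f n"
  unfolding scaleC_hardy_def
  by (subst hardy_coeff_Abs[OF square_summable_scaleC[OF hardy_coeff(1)[of f]]])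
     (auto simp: hardy_coeff disc_series_scaleC)

lemma hardy_coeff_uminus: "hardy_coeff (- f :: 'a hardy) n = - hardy_coeff f n"
proof -
  have "(-1) *\<^sub>C hardy_coeff f n = (-1::real) *\<^sub>R hardy_coeff f n"
    unfolding scaleR_scaleC by simp
  then show ?thesis unfolding uminus_hardy_def hardy_coeff_scaleC by simp
qed

lemma inner_hardy_self: "inner f f = (suminf (\<lambda>n. (norm (hardy_coeff (f :: 'a hardy) n))\<^sup>2))"
proof -
  have "summable (\<lambda>n. (norm (hardy_coeff f n))\<^sup>2)"
    using hardy_coeff(1)[of f] by (simp add: square_summable_def)
  then have "(suminf (\<lambda>n. complex_of_real ((norm (hardy_coeff f n))\<^sup>2)))
      = complex_of_real (suminf (\<lambda>n. (norm (hardy_coeff f n))\<^sup>2))"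
    by (rule suminf_of_real[symmetric])
  then show ?thesis unfolding inner_hardy_def cinner_hardy_def cinner_self by simp
qed

lemma cinner_add_left_hardy: "cinner (f + g) (h :: 'a hardy) = cinner f h + cinner g h"
  unfolding cinner_hardy_def hardy_coeff_add cinner_add_left
  by (intro suminf_add[symmetric] summable_cinner hardy_coeff)

lemma cinner_scaleC_left_hardy: "cinner (c *\<^sub>C f) (h :: 'a hardy) = c * cinner f h"
  unfolding cinner_hardy_def hardy_coeff_scaleC cinner_scaleC_left
  by (intro suminf_mult summable_cinner hardy_coeff)

lemma cinner_commute_hardy: "cinner f (g :: 'a hardy) = cnj (cinner g f)"
proof -
  have "(\<lambda>n. cnj (cinner (hardy_coeff g n) (hardy_coeff f n))) sums cnj (cinner g f)"
    unfolding cinner_hardy_def sums_cnj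
    by (intro summable_sums summable_cinner hardy_coeff)
  then show ?thesis
    unfolding cinner_hardy_def cinner_commute[symmetric] by (simp add: sums_iff)
qed

instance
proof
  fix f g h :: "'a hardy" and r s :: real and c d :: complex
  show "f + g + h = f + (g + h)" by (rule hardy_eqI) (simp add: hardy_coeff_add)
  show "f + g = g + f" by (rule hardy_eqI) (simp add: hardy_coeff_add)
  show "0 + f = f" by (rule hardy_eqI) (simp add: hardy_coeff_add hardy_coeff_zero)
  show "- f + f = 0"
    by (rule hardy_eqI) (simp add: hardy_coeff_add hardy_coeff_zero hardy_coeff_uminus)
  show "f - g = f + - g" by (rule minus_hardy_def)
  show "r *\<^sub>R (f + g) = r *\<^sub>R f + r *\<^sub>R g"
    by (rule hardy_eqI)
       (simp add: scaleR_hardy_def hardy_coeff_add hardy_coeff_scaleC scaleC_add_right)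
  show "(r + s) *\<^sub>R f = r *\<^sub>R f + s *\<^sub>R f"
    by (rule hardy_eqI)
       (simp add: scaleR_hardy_def hardy_coeff_add hardy_coeff_scaleC scaleC_add_left)
  show "r *\<^sub>R s *\<^sub>R f = (r * s) *\<^sub>R f"
    by (rule hardy_eqI) (simp add: scaleR_hardy_def hardy_coeff_scaleC scaleC_scaleC)
  show "1 *\<^sub>R f = f"
    by (rule hardy_eqI)
       (simp add: scaleR_hardy_def hardy_coeff_scaleC scaleC_one)
  show "dist f g = norm (f - g)" by (rule dist_hardy_def)
  show "sgn f = inverse (norm f) *\<^sub>R f" by (rule sgn_hardy_def)
  show "(uniformity :: ('a hardy \<times> 'a hardy) filter)
      = (INF e\<in>{0 <..}. principal {(x, y). dist x y < e})" by (rule uniformity_hardy_def)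
  show "open U \<longleftrightarrow> (\<forall>x\<in>U. \<forall>\<^sub>F (x', y) in uniformity. x' = x \<longrightarrow> y \<in> U)"
    for U :: "'a hardy set" by (rule open_hardy_def)
  show "norm f = sqrt (inner f f)" by (rule norm_hardy_def)
  show "inner f g = Re (cinner f g)" by (rule inner_hardy_def)
  show "inner f g = inner g f"
    unfolding inner_hardy_def by (subst cinner_commute_hardy) simp
  show "inner (f + g) h = inner f h + inner g h"
    by (simp add: inner_hardy_def cinner_add_left_hardy)
  show "inner (r *\<^sub>R f) g = r * inner f g"
    by (simp add: inner_hardy_def scaleR_hardy_def cinner_scaleC_left_hardy)
  have sm: "summable (\<lambda>n. (norm (hardy_coeff f n))\<^sup>2)"
    using hardy_coeff(1)[of f] by (simp add: square_summable_def)
  show "0 \<le> inner f f"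
    unfolding inner_hardy_self by (intro suminf_nonneg sm) simp
  have "inner f f = 0 \<longleftrightarrow> (\<forall>n. hardy_coeff f n = 0)"
    unfolding inner_hardy_self by (subst suminf_eq_zero_iff[OF sm]) auto
  also have "\<dots> \<longleftrightarrow> f = 0"
    by (auto simp: hardy_coeff_zero intro: hardy_eqI)
  finally show "inner f f = 0 \<longleftrightarrow> f = 0" .
  show "c *\<^sub>C (f + g) = c *\<^sub>C f + c *\<^sub>C g"
    by (rule hardy_eqI) (simp add: hardy_coeff_add hardy_coeff_scaleC scaleC_add_right)
  show "(c + d) *\<^sub>C f = c *\<^sub>C f + d *\<^sub>C f"
    by (rule hardy_eqI) (simp add: hardy_coeff_add hardy_coeff_scaleC scaleC_add_left)
  show "c *\<^sub>C d *\<^sub>C f = (c * d) *\<^sub>C f"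
    by (rule hardy_eqI) (simp add: hardy_coeff_scaleC scaleC_scaleC)
  show "r *\<^sub>R f = complex_of_real r *\<^sub>C f" by (rule scaleR_hardy_def)
  show "cinner f g = cnj (cinner g f)" by (rule cinner_commute_hardy)
  show "cinner (f + g) h = cinner f h + cinner g h" by (rule cinner_add_left_hardy)
  show "cinner (c *\<^sub>C f) g = c * cinner f g" by (rule cinner_scaleC_left_hardy)
qed

end

lemma hardy_coeff_diff: "hardy_coeff (f - g) n = hardy_coeff f n - hardy_coeff g n"
  unfolding diff_conv_add_uminus hardy_coeff_add hardy_coeff_uminus ..

lemma norm_hardy_sums: "(\<lambda>n. (norm (hardy_coeff f n))\<^sup>2) sums (norm f)\<^sup>2"
  using hardy_coeff(1)[of f]
  by (simp add: square_summable_def power2_norm_eq_inner inner_hardy_self summable_sums)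

lemma sum_coeff_le: "(\<Sum>n<N. (norm (hardy_coeff f n))\<^sup>2) \<le> (norm f)\<^sup>2"
  using sum_le_suminf[of "\<lambda>n. (norm (hardy_coeff f n))\<^sup>2" "{..<N}"] norm_hardy_sums[of f]
  by (simp add: sums_iff)

lemma norm_hardy_coeff_le: "norm (hardy_coeff f n) \<le> norm f"
proof -
  have "(norm (hardy_coeff f n))\<^sup>2 \<le> (\<Sum>k<Suc n. (norm (hardy_coeff f k))\<^sup>2)"
    by simp (simp add: sum_nonneg)
  also have "\<dots> \<le> (norm f)\<^sup>2" by (rule sum_coeff_le)
  finally show ?thesis by (rule power2_le_imp_le) simp
qed

instance hardy :: (chilbert_space) chilbert_space
proof
  fix X :: "nat \<Rightarrow> 'a hardy"
  assume X: "Cauchy X"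
  have "Cauchy (\<lambda>k. hardy_coeff (X k) n)" for n
  proof (rule CauchyI)
    fix e :: real assume "0 < e"
    from CauchyD[OF X this] obtain M where "\<forall>m\<ge>M. \<forall>k\<ge>M. norm (X m - X k) < e" by blast
    then show "\<exists>M. \<forall>m\<ge>M. \<forall>k\<ge>M. norm (hardy_coeff (X m) n - hardy_coeff (X k) n) < e"
      by (metis hardy_coeff_diff norm_hardy_coeff_le order_le_less_trans)
  qed
  then have "\<exists>l. (\<lambda>k. hardy_coeff (X k) n) \<longlonglongrightarrow> l" for n
    by (simp add: Cauchy_convergent convergentD)
  then obtain l where l: "\<And>n. (\<lambda>k. hardy_coeff (X k) n) \<longlonglongrightarrow> l n" by metis
  have tail: "\<exists>M. \<forall>m\<ge>M. \<forall>N. (\<Sum>n<N. (norm (hardy_coeff (X m) n - l n))\<^sup>2) \<le> e\<^sup>2"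
    if "0 < e" for e
  proof -
    from CauchyD[OF X that] obtain M where M: "\<forall>m\<ge>M. \<forall>k\<ge>M. norm (X m - X k) < e" by blast
    have "(\<Sum>n<N. (norm (hardy_coeff (X m) n - l n))\<^sup>2) \<le> e\<^sup>2" if "m \<ge> M" for m N
    proof (rule LIMSEQ_le_const2)
      show "(\<lambda>k. \<Sum>n<N. (norm (hardy_coeff (X m) n - hardy_coeff (X k) n))\<^sup>2)
          \<longlonglongrightarrow> (\<Sum>n<N. (norm (hardy_coeff (X m) n - l n))\<^sup>2)"
        by (intro tendsto_intros l)
      have "(\<Sum>n<N. (norm (hardy_coeff (X m) n - hardy_coeff (X k) n))\<^sup>2) \<le> e\<^sup>2"
        if "k \<ge> M" for k
        using sum_coeff_le[where N = N and f = "X m - X k"] M \<open>m \<ge> M\<close> that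
        by (simp add: hardy_coeff_diff)
           (smt (verit) norm_ge_zero power_mono)
      then show "\<exists>M. \<forall>k\<ge>M. (\<Sum>n<N. (norm (hardy_coeff (X m) n - hardy_coeff (X k) n))\<^sup>2) \<le> e\<^sup>2"
        by blast
    qed
    then show ?thesis by blast
  qed
  obtain M where M: "\<And>N. (\<Sum>n<N. (norm (hardy_coeff (X M) n - l n))\<^sup>2) \<le> 1\<^sup>2"
    using tail[of 1] by auto
  have "square_summable (\<lambda>n. hardy_coeff (X M) n - l n)"
    unfolding square_summable_def by (rule summableI_nonneg_bounded[OF _ M]) simp
  from square_summable_add[OF hardy_coeff(1)[of "X M"] square_summable_scaleC[OF this, of "-1"]]
  have ss: "square_summable (\<lambda>n. hardy_coeff (X M) n + (-1) *\<^sub>C (hardy_coeff (X M) n - l n))" .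
  have "(-1) *\<^sub>C x = - x" for x :: 'a
    using scaleR_scaleC[of "-1" x] by simp
  with ss have ss: "square_summable l" by simp
  define L where "L = Abs_hardy (disc_series l)"
  have L: "hardy_coeff L = l" unfolding L_def by (rule hardy_coeff_Abs[OF ss refl])
  have "X \<longlonglongrightarrow> L"
  proof (rule LIMSEQ_I)
    fix e :: real assume "0 < e"
    then obtain M where
      M: "\<And>m N. m \<ge> M \<Longrightarrow> (\<Sum>n<N. (norm (hardy_coeff (X m) n - l n))\<^sup>2) \<le> (e/2)\<^sup>2"
      using tail[of "e/2"] by auto
    have "norm (X m - L) < e" if "m \<ge> M" for m
    proof -
      have "(norm (X m - L))\<^sup>2 \<le> (e/2)\<^sup>2"
      proof (rule LIMSEQ_le_const2)
        show "(\<lambda>N. \<Sum>n<N. (norm (hardy_coeff (X m) n - l n))\<^sup>2) \<longlonglongrightarrow> (norm (X m - L))\<^sup>2"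
          using norm_hardy_sums[of "X m - L"] by (simp add: sums_def hardy_coeff_diff L)
        show "\<exists>M. \<forall>N\<ge>M. (\<Sum>n<N. (norm (hardy_coeff (X m) n - l n))\<^sup>2) \<le> (e/2)\<^sup>2"
          using M[OF that] by blast
      qed
      then have "norm (X m - L) \<le> e/2"
        by (rule power2_le_imp_le) (use \<open>0 < e\<close> in simp)
      then show ?thesis using \<open>0 < e\<close> by simp
    qed
    then show "\<exists>no. \<forall>n\<ge>no. norm (X n - L) < e" by blast
  qed
  then show "convergent X" by (rule convergentI)
qed

section \<open>Bounded operators\<close>

definition bounded_clinear :: "('a::complex_inner \<Rightarrow> 'b::complex_inner) \<Rightarrow> bool" where
  "bounded_clinear T \<longleftrightarrow> bounded_linear T \<and> (\<forall>c x. T (c *\<^sub>C x) = c *\<^sub>C T x)"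

definition adj :: "('h::chilbert_space \<Rightarrow> 'h) \<Rightarrow> 'h \<Rightarrow> 'h" where
  "adj T = (THE S. \<forall>x y. cinner (T x) y = cinner x (S y))"

definition commutator :: "('h::chilbert_space \<Rightarrow> 'h) \<Rightarrow> ('h \<Rightarrow> 'h) \<Rightarrow> 'h \<Rightarrow> 'h" where
  "commutator S T = (\<lambda>x. S (T x) - T (S x))"

text \<open>The inserted \<open>0\<close> only matters on the zero space, which has no unit vectors.\<close>

definition numerical_radius :: "('h::chilbert_space \<Rightarrow> 'h) \<Rightarrow> real" where
  "numerical_radius T = Sup (insert 0 {cmod (cinner (T x) x) | x. norm x = 1})"

definition positive_op :: "('h::chilbert_space \<Rightarrow> 'h) \<Rightarrow> bool" where
  "positive_op P \<longleftrightarrow> bounded_clinear P \<and> (\<forall>x. cinner (P x) x \<in> \<real> \<and> 0 \<le> Re (cinner (P x) x))"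

definition pos_sqrt :: "('h::chilbert_space \<Rightarrow> 'h) \<Rightarrow> 'h \<Rightarrow> 'h" where
  "pos_sqrt P = (THE D. positive_op D \<and> D \<circ> D = P)"

definition defect_op :: "('h::chilbert_space \<Rightarrow> 'h) \<Rightarrow> 'h \<Rightarrow> 'h" where
  "defect_op T = pos_sqrt (\<lambda>x. x - adj T (T x))"

definition defect_space :: "('h::chilbert_space \<Rightarrow> 'h) \<Rightarrow> 'h set" where
  "defect_space T = closure (range (defect_op T))"

text \<open>Operators on a closed subspace \<open>S\<close> are total functions whose values off \<open>S\<close> are
  irrelevant.\<close>

definition clinear_on :: "'h::complex_inner set \<Rightarrow> ('h \<Rightarrow> 'k::complex_inner) \<Rightarrow> bool" where
  "clinear_on S F \<longleftrightarrow>
     (\<forall>x\<in>S. \<forall>y\<in>S. F (x + y) = F x + F y) \<and> (\<forall>c. \<forall>x\<in>S. F (c *\<^sub>C x) = c *\<^sub>C F x)"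

definition bounded_op_on :: "'h::complex_inner set \<Rightarrow> ('h \<Rightarrow> 'h) \<Rightarrow> bool" where
  "bounded_op_on S F \<longleftrightarrow>
     clinear_on S F \<and> F ` S \<subseteq> S \<and> (\<exists>K. \<forall>x\<in>S. norm (F x) \<le> K * norm x)"

definition unitary_from :: "'h::complex_inner set \<Rightarrow> ('h \<Rightarrow> 'e::complex_inner) \<Rightarrow> bool" where
  "unitary_from S U \<longleftrightarrow>
     clinear_on S U \<and> (\<forall>x\<in>S. \<forall>y\<in>S. cinner (U x) (U y) = cinner x y) \<and> U ` S = UNIV"

section \<open>Taylor joint spectrum of a triple\<close>

text \<open>Exactness of the Koszul complex \<open>0 \<rightarrow> H \<rightarrow> H\<^sup>3 \<rightarrow> H\<^sup>3 \<rightarrow> H \<rightarrow> 0\<close>, with coordinates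
  of the middle terms indexed by \<open>e1, e2, e3\<close> and \<open>e1 e2, e1 e3, e2 e3\<close>.\<close>

definition koszul0 :: "('h \<Rightarrow> 'h) \<Rightarrow> ('h \<Rightarrow> 'h) \<Rightarrow> ('h \<Rightarrow> 'h) \<Rightarrow> 'h \<Rightarrow> 'h::chilbert_space \<times> 'h \<times> 'h" where
  "koszul0 T1 T2 T3 x = (T1 x, T2 x, T3 x)"

definition koszul1 ::
    "('h \<Rightarrow> 'h) \<Rightarrow> ('h \<Rightarrow> 'h) \<Rightarrow> ('h \<Rightarrow> 'h) \<Rightarrow> 'h \<times> 'h \<times> 'h \<Rightarrow> 'h::chilbert_space \<times> 'h \<times> 'h" where
  "koszul1 T1 T2 T3 = (\<lambda>(x1, x2, x3). (T1 x2 - T2 x1, T1 x3 - T3 x1, T2 x3 - T3 x2))"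

definition koszul2 ::
    "('h \<Rightarrow> 'h) \<Rightarrow> ('h \<Rightarrow> 'h) \<Rightarrow> ('h \<Rightarrow> 'h) \<Rightarrow> 'h \<times> 'h \<times> 'h \<Rightarrow> 'h::chilbert_space" where
  "koszul2 T1 T2 T3 = (\<lambda>(x12, x13, x23). T1 x23 - T2 x13 + T3 x12)"

definition koszul_exact ::
    "('h::chilbert_space \<Rightarrow> 'h) \<Rightarrow> ('h \<Rightarrow> 'h) \<Rightarrow> ('h \<Rightarrow> 'h) \<Rightarrow> bool" where
  "koszul_exact T1 T2 T3 \<longleftrightarrow>
     {x. koszul0 T1 T2 T3 x = 0} = {0} \<and>
     {u. koszul1 T1 T2 T3 u = 0} = range (koszul0 T1 T2 T3) \<and>
     {u. koszul2 T1 T2 T3 u = 0} = range (koszul1 T1 T2 T3) \<and>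
     range (koszul2 T1 T2 T3) = UNIV"

definition taylor_spectrum ::
    "('h::chilbert_space \<Rightarrow> 'h) \<Rightarrow> ('h \<Rightarrow> 'h) \<Rightarrow> ('h \<Rightarrow> 'h) \<Rightarrow> (complex \<times> complex \<times> complex) set" where
  "taylor_spectrum T1 T2 T3 =
     {(l1, l2, l3). \<not> koszul_exact (\<lambda>x. T1 x - l1 *\<^sub>C x) (\<lambda>x. T2 x - l2 *\<^sub>C x) (\<lambda>x. T3 x - l3 *\<^sub>C x)}"

section \<open>Tetrablock contractions and fundamental operators\<close>

definition tetrablock :: "(complex \<times> complex \<times> complex) set" where
  "tetrablock = {(x1, x2, x3).
     \<forall>z w. cmod z \<le> 1 \<longrightarrow> cmod w \<le> 1 \<longrightarrow> 1 - z * x1 - w * x2 + z * w * x3 \<noteq> 0}"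

text \<open>A polynomial in three variables is the finitely supported map from exponents to
  coefficients.\<close>

type_synonym poly3 = "(nat \<times> nat \<times> nat) \<Rightarrow>\<^sub>0 complex"

definition eval_poly3 :: "poly3 \<Rightarrow> complex \<times> complex \<times> complex \<Rightarrow> complex" where
  "eval_poly3 p = (\<lambda>(x1, x2, x3).
     \<Sum>(i, j, k)\<in>Poly_Mapping.keys p. Poly_Mapping.lookup p (i, j, k) * x1 ^ i * x2 ^ j * x3 ^ k)"

definition op_poly3 ::
    "poly3 \<Rightarrow> ('h::chilbert_space \<Rightarrow> 'h) \<Rightarrow> ('h \<Rightarrow> 'h) \<Rightarrow> ('h \<Rightarrow> 'h) \<Rightarrow> 'h \<Rightarrow> 'h" where
  "op_poly3 p T1 T2 T3 x =
     (\<Sum>(i, j, k)\<in>Poly_Mapping.keys p.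
        Poly_Mapping.lookup p (i, j, k) *\<^sub>C (T1 ^^ i) ((T2 ^^ j) ((T3 ^^ k) x)))"

text \<open>The supremum is that of a nonempty bounded set, as the closed tetrablock lies in the
  closed unit polydisc.\<close>

definition tetrablock_contraction ::
    "('h::chilbert_space \<Rightarrow> 'h) \<Rightarrow> ('h \<Rightarrow> 'h) \<Rightarrow> ('h \<Rightarrow> 'h) \<Rightarrow> bool" where
  "tetrablock_contraction T1 T2 T3 \<longleftrightarrow>
     bounded_clinear T1 \<and> bounded_clinear T2 \<and> bounded_clinear T3 \<and>
     T1 \<circ> T2 = T2 \<circ> T1 \<and> T1 \<circ> T3 = T3 \<circ> T1 \<and> T2 \<circ> T3 = T3 \<circ> T2 \<and>
     taylor_spectrum T1 T2 T3 \<subseteq> closure tetrablock \<and>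
     (\<forall>p. onorm (op_poly3 p T1 T2 T3) \<le> (SUP x\<in>closure tetrablock. cmod (eval_poly3 p x)))"

definition fundamental_operators ::
    "('h::chilbert_space \<Rightarrow> 'h) \<Rightarrow> ('h \<Rightarrow> 'h) \<Rightarrow> ('h \<Rightarrow> 'h) \<Rightarrow> ('h \<Rightarrow> 'h) \<Rightarrow> ('h \<Rightarrow> 'h) \<Rightarrow> bool" where
  "fundamental_operators T1 T2 T3 F1 F2 \<longleftrightarrow>
     bounded_op_on (defect_space T3) F1 \<and> bounded_op_on (defect_space T3) F2 \<and>
     (\<forall>x. T1 x - adj T2 (T3 x) = defect_op T3 (F1 (defect_op T3 x))) \<and>
     (\<forall>x. T2 x - adj T1 (T3 x) = defect_op T3 (F2 (defect_op T3 x)))"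

end

theory Submission
  imports Defs
begin

text \<open>
  On Taylor coefficients, the contraction is the triple
  \<open>(T1 f)\<^sub>n = A1 f\<^sub>n + A2\<^sup>* f\<^sub>n\<^sub>+\<^sub>1\<close>,
  \<open>(T2 f)\<^sub>n = A2 f\<^sub>n + A1\<^sup>* f\<^sub>n\<^sub>+\<^sub>1\<close>,
  \<open>(T3 f)\<^sub>n = f\<^sub>n\<^sub>+\<^sub>1\<close>, that is, the adjoints of multiplication by
  \<open>A1\<^sup>* + z A2\<close>, \<open>A2\<^sup>* + z A1\<close> and \<open>z\<close>.  The hypotheses on commutators make it a commuting
  triple.  The backward shift \<open>T3\<close> has the projection onto the constants as its defect operator, and
  \<open>T1 - T2\<^sup>* T3\<close> and \<open>T2 - T1\<^sup>* T3\<close> act as \<open>A1\<close> and \<open>A2\<close> on the constants and kill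
  everything else; so \<open>A1\<close> and \<open>A2\<close> are the fundamental operators.

  The von Neumann inequality is checked on symbols.  At a point \<open>u\<close> of the unit circle the three
  symbols are \<open>u N\<^sup>*\<close>, \<open>N\<close> and \<open>u\<close> with \<open>N = A2 + u A1\<^sup>*\<close>, and the hypotheses say precisely
  that \<open>N\<close> is normal with numerical radius at most one.  Any operator \<open>B\<close> that commutes with \<open>N\<close> and
  \<open>N\<^sup>*\<close> nearly attains its norm on joint approximate eigenvectors of \<open>N\<close> and \<open>N\<^sup>*\<close>
  (\<open>approx_eigen_bound_commuting\<close>).  Hence a polynomial in the symbols at \<open>u\<close> is bounded by the values
  of the polynomial at the points \<open>(u l\<^sup>*, l, u)\<close> with \<open>l\<close> in the closed disc, and these points lie
  in the closed tetrablock.  Parseval's identity over roots of unity transfers a uniform bound on symbols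
  to the Toeplitz operators (\<open>norm_le_of_cosymbol_bound\<close>).

  For the joint spectrum, a point \<open>(l1, l2, l3)\<close> outside the closed tetrablock is a zero of
  \<open>1 - z x1 - w x2 + z w x3\<close> for some \<open>z\<close>, \<open>w\<close> in the open disc.  Then
  \<open>Q = 1 - z T1 - w T2 + z w T3\<close> is a linear combination of the operators \<open>Ti - li\<close>, so the
  inverse of \<open>Q\<close> provides a contracting homotopy of the Koszul complex
  (\<open>koszul_exact_of_bij_combination\<close>).  That \<open>Q\<close> is invertible follows from the factorisation
  \<open>Q = (1 - w C) (1 - z T1)\<close>, where \<open>C = (T2 - z T3) (1 - z T1)\<^sup>-\<^sup>1\<close> is a contraction
  (\<open>resolvent_contraction\<close>) for the same reason as above: on symbols \<open>C\<close> is a Blaschke factor of \<open>N\<close>.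
\<close>

section \<open>Complex Hilbert spaces\<close>

lemma scaleC_zero_left: "0 *\<^sub>C x = 0"
  using scaleR_scaleC[of 0 x] by simp

lemma scaleC_minus_right: "c *\<^sub>C (- x) = - (c *\<^sub>C x)"
  by (rule linear_neg[OF bounded_linear.linear[OF bounded_linear_scaleC]])

lemma scaleC_minus_left: "(- c) *\<^sub>C x = - (c *\<^sub>C x)"
  using scaleC_add_left[of c "- c" x] by (simp add: scaleC_zero_left eq_neg_iff_add_eq_0 add.commute)

lemma scaleC_diff_right: "c *\<^sub>C (x - y) = c *\<^sub>C x - c *\<^sub>C y"
  using scaleC_add_right[of c x "- y"] by (simp add: scaleC_minus_right)

lemma scaleC_diff_left: "(c - d) *\<^sub>C x = c *\<^sub>C x - d *\<^sub>C x"
  using scaleC_add_left[of c "- d" x] by (simp add: scaleC_minus_left)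

lemma scaleC_sum_right: "c *\<^sub>C sum f I = (\<Sum>i\<in>I. c *\<^sub>C f i)"
  by (rule linear_sum[OF bounded_linear.linear[OF bounded_linear_scaleC]])

lemma scaleC_left_commute: "c *\<^sub>C d *\<^sub>C x = d *\<^sub>C c *\<^sub>C x"
  by (simp add: scaleC_scaleC mult.commute)

lemmas scaleC_simps = scaleC_zero_left scaleC_zero_right scaleC_one scaleC_minus_left
  scaleC_minus_right scaleC_diff_left scaleC_diff_right scaleC_add_left scaleC_add_right
  scaleC_scaleC

lemma linear_cinner_left: "linear (\<lambda>x. cinner x y)"
  by (rule bounded_linear.linear[OF bounded_linear_cinner_left])

lemma cinner_diff_left: "cinner (x - y) z = cinner x z - cinner y z"
  by (rule linear_diff[OF linear_cinner_left])

lemma cinner_sum_left: "cinner (sum f I) y = (\<Sum>i\<in>I. cinner (f i) y)"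
  by (rule linear_sum[OF linear_cinner_left])

lemma cinner_zero_left: "cinner 0 y = 0"
  by (rule linear_0[OF linear_cinner_left])

lemma cinner_zero_right: "cinner x 0 = 0"
  by (metis cinner_commute cinner_zero_left complex_cnj_zero)

lemma cinner_diff_right: "cinner x (y - z) = cinner x y - cinner x z"
  by (metis cinner_commute cinner_diff_left complex_cnj_diff)

lemma cinner_sum_right: "cinner x (sum f I) = (\<Sum>i\<in>I. cinner x (f i))"
  by (induction I rule: infinite_finite_induct) (simp_all add: cinner_zero_right cinner_add_right)

lemmas cinner_simps = cinner_add_left cinner_add_right cinner_diff_left cinner_diff_right
  cinner_scaleC_left cinner_scaleC_right cinner_zero_left cinner_zero_right

lemma cinner_ext:
  assumes "\<And>y. cinner x y = cinner x' y"
  shows "x = x'"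
proof -
  have "cinner (x - x') (x - x') = 0" using assms by (simp add: cinner_diff_left)
  then show ?thesis by (simp add: cinner_self)
qed

section \<open>Bounded operators and their adjoints\<close>

lemma bounded_clinearI:
  assumes "\<And>x y. T (x + y) = T x + T y" and "\<And>c x. T (c *\<^sub>C x) = c *\<^sub>C T x"
    and "\<And>x. norm (T x) \<le> K * norm x"
  shows "bounded_clinear T"
  unfolding bounded_clinear_def
  by (auto intro!: bounded_linear_intro[where K = K] simp: assms scaleR_scaleC mult.commute)

lemma
  assumes T: "bounded_clinear T"
  shows bounded_clinear_bounded_linear: "bounded_linear T"
    and bounded_clinear_add: "T (x + y) = T x + T y"
    and bounded_clinear_diff: "T (x - y) = T x - T y"
    and bounded_clinear_zero: "T 0 = 0"
    and bounded_clinear_scaleC: "T (c *\<^sub>C x) = c *\<^sub>C T x"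
    and bounded_clinear_sum: "T (sum f I) = (\<Sum>i\<in>I. T (f i))"
proof -
  show bl: "bounded_linear T" using T by (simp add: bounded_clinear_def)
  then have l: "linear T" by (rule bounded_linear.linear)
  show "T (x + y) = T x + T y" "T (x - y) = T x - T y" "T 0 = 0" "T (sum f I) = (\<Sum>i\<in>I. T (f i))"
    using linear_add[OF l] linear_diff[OF l] linear_0[OF l] linear_sum[OF l] by auto
  show "T (c *\<^sub>C x) = c *\<^sub>C T x" using T by (simp add: bounded_clinear_def)
qed

lemmas bounded_clinear_simps = bounded_clinear_add bounded_clinear_diff bounded_clinear_zero
  bounded_clinear_scaleC bounded_clinear_sum

lemma bounded_clinear_boundedE:
  assumes "bounded_clinear T"
  obtains K where "K > 0" "\<And>x. norm (T x) \<le> K * norm x"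
  using bounded_linear.pos_bounded[OF bounded_clinear_bounded_linear[OF assms]]
  by (auto simp: mult.commute)

lemma bounded_clinear_id: "bounded_clinear (\<lambda>x. x)"
  by (simp add: bounded_clinear_def)

lemma bounded_clinear_zero_op: "bounded_clinear (\<lambda>x. 0)"
  by (simp add: bounded_clinear_def scaleC_zero_right)

lemma bounded_clinear_compose:
  "bounded_clinear S \<Longrightarrow> bounded_clinear T \<Longrightarrow> bounded_clinear (\<lambda>x. S (T x))"
  by (auto simp: bounded_clinear_def intro: bounded_linear_compose)

lemma bounded_clinear_plus:
  "bounded_clinear S \<Longrightarrow> bounded_clinear T \<Longrightarrow> bounded_clinear (\<lambda>x. S x + T x)"
  by (auto simp: bounded_clinear_def scaleC_add_right intro: bounded_linear_add)

lemma bounded_clinear_minus: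
  "bounded_clinear S \<Longrightarrow> bounded_clinear T \<Longrightarrow> bounded_clinear (\<lambda>x. S x - T x)"
  by (auto simp: bounded_clinear_def scaleC_diff_right intro: bounded_linear_sub)

lemma bounded_clinear_scaled:
  "bounded_clinear T \<Longrightarrow> bounded_clinear (\<lambda>x. c *\<^sub>C T x)"
  by (auto simp: bounded_clinear_def scaleC_left_commute
      intro: bounded_linear_compose[OF bounded_linear_scaleC])

lemma bounded_clinear_setsum:
  "(\<And>i. i \<in> I \<Longrightarrow> bounded_clinear (T i)) \<Longrightarrow> bounded_clinear (\<lambda>x. \<Sum>i\<in>I. T i x)"
  by (induction I rule: infinite_finite_induct)
     (simp_all add: bounded_clinear_zero_op bounded_clinear_plus)

lemma bounded_clinear_funpow:
  fixes T :: "'h::complex_inner \<Rightarrow> 'h"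
  assumes "bounded_clinear T"
  shows "bounded_clinear (T ^^ n)"
proof (induction n)
  case 0
  show ?case by (simp add: id_def bounded_clinear_id)
next
  case (Suc n)
  show ?case using bounded_clinear_compose[OF assms Suc] by (simp add: comp_def)
qed

lemma bounded_clinear_op_poly3:
  assumes "bounded_clinear T1" "bounded_clinear T2" "bounded_clinear T3"
  shows "bounded_clinear (op_poly3 p T1 T2 T3)"
  unfolding op_poly3_def using assms
  by (auto simp: case_prod_unfold intro!: bounded_clinear_setsum bounded_clinear_scaled
      bounded_clinear_compose[of "T1 ^^ _"] bounded_clinear_compose[of "T2 ^^ _"]
      bounded_clinear_funpow)

text \<open>The representing vector is the minimiser of \<open>J x = |x|\<^sup>2 - 2 f x\<close>: the parallelogram law makes every
  minimising sequence Cauchy, and the first variation of \<open>J\<close> at its minimiser gives the claim.\<close>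

lemma riesz_representation:
  fixes f :: "'h::{real_inner,complete_space} \<Rightarrow> real"
  assumes f: "bounded_linear f"
  obtains v where "\<And>x. f x = inner v x"
proof -
  obtain K where K: "K > 0" "\<And>x. \<bar>f x\<bar> \<le> K * norm x"
    using bounded_linear.pos_bounded[OF f] by (auto simp: mult.commute)
  define J where "J x = (norm x)\<^sup>2 - 2 * f x" for x
  have low: "J x \<ge> - K\<^sup>2" for x
  proof -
    have "0 \<le> (norm x - K)\<^sup>2" by simp
    then show ?thesis using K(2)[of x] by (simp add: J_def power2_eq_square algebra_simps abs_le_iff)
  qed
  define m where "m = Inf (range J)"
  have bdd: "bdd_below (range J)" using low by (auto intro!: bdd_belowI2)
  have m_le: "m \<le> J x" for x unfolding m_def using bdd by (simp add: cInf_lower)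
  have "\<exists>x. J x < m + inverse (Suc n)" for n
    using cInf_lessD[of "range J" "m + inverse (Suc n)"] by (auto simp: m_def)
  then obtain X where X: "\<And>n. J (X n) < m + inverse (Suc n)" by metis
  note fl = linear_add[OF bounded_linear.linear[OF f]] linear_scale[OF bounded_linear.linear[OF f]]
  have par: "(norm (x - y))\<^sup>2 \<le> 2 * (J x - m) + 2 * (J y - m)" for x y
  proof -
    have "(norm (x - y))\<^sup>2 = 2 * J x + 2 * J y - 4 * J ((1/2) *\<^sub>R (x + y))"
      unfolding J_def fl power2_norm_eq_inner
      by (simp add: inner_simps inner_commute algebra_simps)
    then show ?thesis using m_le[of "(1/2) *\<^sub>R (x + y)"] by simp
  qed
  have "Cauchy X"
  proof (rule CauchyI)
    fix e :: real assume e: "0 < e"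
    obtain M where M: "inverse (Suc M) < e\<^sup>2 / 4"
      using reals_Archimedean[of "e\<^sup>2 / 4"] e by auto
    have close: "J (X n) - m < e\<^sup>2 / 4" if "n \<ge> M" for n
    proof -
      have "inverse (real (Suc n)) \<le> inverse (real (Suc M))" using that by (intro le_imp_inverse_le) auto
      then show ?thesis using X[of n] M by linarith
    qed
    have "norm (X k - X n) < e" if "k \<ge> M" "n \<ge> M" for k n
    proof -
      have "(norm (X k - X n))\<^sup>2 < e\<^sup>2"
        using par[of "X k" "X n"] close[OF that(1)] close[OF that(2)] by argo
      then show ?thesis using e by (auto intro: power2_less_imp_less)
    qed
    then show "\<exists>M. \<forall>k\<ge>M. \<forall>n\<ge>M. norm (X k - X n) < e" by blast
  qed
  then obtain v where v: "X \<longlonglongrightarrow> v" using Cauchy_convergent convergentD by blast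
  have "(\<lambda>n. J (X n)) \<longlonglongrightarrow> J v"
    unfolding J_def by (intro tendsto_intros v bounded_linear.tendsto[OF f])
  moreover have "(\<lambda>n. m + inverse (real (Suc n))) \<longlonglongrightarrow> m"
    using LIMSEQ_inverse_real_of_nat by (auto intro: tendsto_eq_intros)
  ultimately have "J v \<le> m"
    by (rule LIMSEQ_le) (use X less_imp_le in blast)
  then have min: "J v \<le> J x" for x using m_le order_trans by blast
  have "f x = inner v x" for x
  proof -
    \<comment> \<open>the first variation of \<open>J\<close> at its minimiser \<open>v\<close> in the direction \<open>x\<close> is \<open>2 d\<close>\<close>
    define d where "d = inner v x - f x"
    have quad: "0 \<le> 2 * s * d + s\<^sup>2 * (norm x)\<^sup>2" for s
      using min[of "v + s *\<^sub>R x"] unfolding J_def fl power2_norm_eq_inner d_def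
      by (simp add: inner_simps inner_commute algebra_simps power2_eq_square)
    define c where "c = (norm x)\<^sup>2 + 1"
    have c: "c > 0" "(norm x)\<^sup>2 \<le> c" by (auto simp: c_def add_nonneg_pos)
    have "0 \<le> 2 * (- d / c) * d + (- d / c)\<^sup>2 * c"
      using quad[of "- d / c"] mult_left_mono[OF c(2), of "(- d / c)\<^sup>2"] by simp
    also have "\<dots> = - d\<^sup>2 / c" using c(1) by (simp add: power2_eq_square field_simps)
    finally have "d\<^sup>2 \<le> 0" using c(1) by (simp add: divide_le_0_iff zero_le_divide_iff)
    then show ?thesis by (simp add: d_def)
  qed
  then show ?thesis by (rule that)
qed

text \<open>A relation rather than the operator \<open>adj\<close>, so that explicit adjoints can be used, and passed
  through sums and products, before \<open>adj\<close> is known to be defined.\<close>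

definition adjoint_pair ::
    "('h::complex_inner \<Rightarrow> 'k::complex_inner) \<Rightarrow> ('k \<Rightarrow> 'h) \<Rightarrow> bool" where
  "adjoint_pair T S \<longleftrightarrow> (\<forall>x y. cinner (T x) y = cinner x (S y))"

lemma adjoint_pairD: "adjoint_pair T S \<Longrightarrow> cinner (T x) y = cinner x (S y)"
  by (simp add: adjoint_pair_def)

lemma adjoint_pair_sym: "adjoint_pair T S \<Longrightarrow> adjoint_pair S T"
  unfolding adjoint_pair_def by (metis cinner_commute)

lemma adjoint_pair_unique:
  assumes "adjoint_pair T S" "adjoint_pair T S'"
  shows "S = S'"
proof
  fix y show "S y = S' y"
    by (rule cinner_ext) (metis assms adjoint_pairD adjoint_pair_sym)
qed

lemma adj_eqI: "adjoint_pair T S \<Longrightarrow> adj T = S"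
  unfolding adj_def
  by (rule the_equality) (auto simp: adjoint_pair_def intro: adjoint_pair_unique)

text \<open>The real representation theorem suffices: it gives the real parts, and the imaginary parts are real
  parts at \<open>\<i> x\<close>.\<close>

lemma adjoint_pair_adj:
  assumes T: "bounded_clinear (T :: 'h::chilbert_space \<Rightarrow> 'h)"
  shows "adjoint_pair T (adj T)"
proof -
  have "\<exists>v. \<forall>x. cinner (T x) y = cinner x v" for y
  proof -
    have "bounded_linear (\<lambda>x. inner (T x) y)"
      by (rule bounded_linear_compose[OF bounded_linear_inner_left bounded_clinear_bounded_linear[OF T]])
    then obtain v where "\<And>x. inner (T x) y = inner v x" by (rule riesz_representation) blast
    then have re: "Re (cinner (T x) y) = Re (cinner x v)" for x
      by (metis inner_commute inner_eq_Re_cinner)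
    have "cinner (T x) y = cinner x v" for x
      using re[of x] re[of "\<i> *\<^sub>C x"]
      by (simp add: bounded_clinear_scaleC[OF T] cinner_scaleC_left complex_eq_iff)
    then show ?thesis by blast
  qed
  then obtain S where "adjoint_pair T S" unfolding adjoint_pair_def by metis
  then show ?thesis using adj_eqI by metis
qed

lemma adjoint_pair_norm_le:
  assumes "adjoint_pair T S" and T: "\<And>x. norm (T x) \<le> K * norm x" and "K \<ge> 0"
  shows "norm (S y) \<le> K * norm y"
proof -
  have "(norm (S y))\<^sup>2 = cmod (cinner y (T (S y)))"
    unfolding adjoint_pairD[OF adjoint_pair_sym[OF assms(1)], symmetric] cinner_self norm_of_real
    by simp
  also have "\<dots> \<le> norm y * (K * norm (S y))"
    by (rule order_trans[OF norm_cinner_le]) (simp add: T mult_left_mono)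
  finally have "norm (S y) * norm (S y) \<le> (K * norm y) * norm (S y)"
    by (simp add: power2_eq_square mult_ac)
  then show ?thesis
    by (cases "norm (S y) = 0") (use \<open>K \<ge> 0\<close> in \<open>auto simp: mult_le_cancel_right\<close>)
qed

text \<open>Linearity of an adjoint comes for free from uniqueness of representing vectors.\<close>

lemma bounded_clinear_adjoint:
  assumes T: "bounded_clinear T" and "adjoint_pair T S"
  shows "bounded_clinear S"
proof -
  obtain K where K: "K > 0" "\<And>x. norm (T x) \<le> K * norm x"
    using T by (rule bounded_clinear_boundedE) blast
  note ST = adjoint_pairD[OF adjoint_pair_sym[OF assms(2)]]
  show ?thesis
    using adjoint_pair_norm_le[OF assms(2) K(2)] K(1)
    by (intro bounded_clinearI[where K = K] cinner_ext) (simp_all add: ST cinner_simps)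
qed

section \<open>Joint approximate eigenvectors\<close>

text \<open>For families of commuting operators this replaces a joint eigenspace, which may be zero: the joint
  spectral theory below needs only that unit vectors are nearly annihilated by all members.\<close>

definition approx_kernel :: "('h::real_normed_vector \<Rightarrow> 'h) set \<Rightarrow> bool" where
  "approx_kernel \<G> \<longleftrightarrow> (\<forall>e>0. \<exists>x. norm x = 1 \<and> (\<forall>G\<in>\<G>. norm (G x) \<le> e))"

text \<open>The top of the quadratic form of a self-adjoint \<open>T\<close>, restricted to the approximate kernel of a
  commuting family, is an approximate eigenvalue of \<open>T\<close> there.  On a true invariant subspace this is the
  Cauchy-Schwarz inequality for the positive form of \<open>t - T\<close>.  Approximate kernels are only nearly
  invariant, so instead a nearly maximal unit vector \<open>x\<close> is moved to \<open>y = x + s (T - t) x\<close>: as \<open>y\<close> is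
  again nearly annihilated by the family, its form cannot exceed \<open>t\<close> by much, while the move gains
  \<open>2 s |(T - t) x|\<^sup>2\<close> to first order.  Adding \<open>T - t\<close> to the family allows the argument to be
  repeated for further operators.\<close>

lemma approx_kernel_eigenvalue:
  fixes T :: "'h::real_inner \<Rightarrow> 'h"
  assumes T: "bounded_linear T" and self: "\<And>x y. inner (T x) y = inner x (T y)"
    and lin: "\<And>G. G \<in> \<G> \<Longrightarrow> linear G"
    and comm: "\<And>G x. G \<in> \<G> \<Longrightarrow> G (T x) = T (G x)"
    and ker: "approx_kernel \<G>"
  obtains t where "approx_kernel (insert (\<lambda>x. T x - t *\<^sub>R x) \<G>)"
    and "\<And>x. norm x = 1 \<Longrightarrow> (\<And>G. G \<in> \<G> \<Longrightarrow> G x = 0) \<Longrightarrow> inner (T x) x \<le> t"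
proof -
  obtain K where K: "K > 0" "\<And>x. norm (T x) \<le> K * norm x"
    using bounded_linear.pos_bounded[OF T] by (auto simp: mult.commute)
  note Tl = bounded_linear.linear[OF T]
  define small where "small e x \<longleftrightarrow> norm x = 1 \<and> (\<forall>G\<in>\<G>. norm (G x) \<le> e)" for e and x :: 'h
  have ex_small: "\<exists>x. small e x" if "e > 0" for e
    using ker that unfolding approx_kernel_def small_def by blast
  \<comment> \<open>\<open>t\<close> will be the largest level that the form attains on arbitrarily good approximate kernel vectors\<close>
  define Lo where "Lo = {l. \<forall>e>0. \<exists>x. small e x \<and> l \<le> inner (T x) x}"
  have form: "\<bar>inner (T x) x\<bar> \<le> K" if "norm x = 1" for x
    using Cauchy_Schwarz_ineq2[of "T x" x] K(2)[of x] that by simp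
  have bdd: "bdd_above Lo"
  proof (rule bdd_aboveI)
    fix l assume "l \<in> Lo"
    then obtain x where "small 1 x" "l \<le> inner (T x) x" unfolding Lo_def using zero_less_one by blast
    then show "l \<le> K" using form[of x] unfolding small_def by linarith
  qed
  have "- K \<in> Lo"
    unfolding Lo_def using ex_small form by (fastforce simp: small_def abs_le_iff)
  then have ne: "Lo \<noteq> {}" by blast
  define t where "t = Sup Lo"
  have below: "\<exists>x. small e x \<and> t - d \<le> inner (T x) x" if "d > 0" "e > 0" for d e
  proof -
    have "t - d < Sup Lo" using that(1) by (simp add: t_def)
    then obtain l where "l \<in> Lo" "t - d < l" using less_cSupD[OF ne] by blast
    then show ?thesis using that(2) unfolding Lo_def by (smt (verit) mem_Collect_eq)
  qed
  have above: "\<exists>e>0. \<forall>x. small e x \<longrightarrow> inner (T x) x < t + d" if "d > 0" for d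
  proof -
    have "t + d \<notin> Lo" using cSup_upper[OF _ bdd, of "t + d"] that unfolding t_def by auto
    then show ?thesis unfolding Lo_def by (auto simp: not_le)
  qed
  define U where "U x = T x - t *\<^sub>R x" for x
  have Ub: "bounded_linear U"
    unfolding U_def by (intro bounded_linear_sub T bounded_linear_scaleR_right)
  note Ul = bounded_linear.linear[OF Ub]
  obtain C where C: "C > 0" "\<And>x. norm (U x) \<le> C * norm x"
    using bounded_linear.pos_bounded[OF Ub] by (auto simp: mult.commute)
  have Uself: "inner (U x) y = inner x (U y)" for x y
    by (simp add: U_def inner_simps self)
  have GU: "G (U x) = U (G x)" if "G \<in> \<G>" for G x
    by (simp add: U_def linear_diff[OF lin[OF that]] linear_scale[OF lin[OF that]] comm[OF that])
  have "approx_kernel (insert U \<G>)"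
    unfolding approx_kernel_def
  proof (intro allI impI)
    fix e :: real assume e: "e > 0"
    \<comment> \<open>the first bound keeps \<open>|y|\<close> away from \<open>0\<close>; the second keeps the errors, relative to the gain \<open>2 s |U x|\<^sup>2\<close>, below \<open>e\<^sup>2\<close>\<close>
    define s where "s = min (1 / (2 * C)) (e\<^sup>2 / (2 + C ^ 3))"
    have s: "s > 0" "s * C \<le> 1/2" "s * (2 + C ^ 3) \<le> e\<^sup>2"
    proof -
      have p: "2 + C ^ 3 > 0" using C(1) by (simp add: add_pos_pos)
      show "s > 0" unfolding s_def using C(1) e p by simp
      have "s \<le> 1 / (2 * C)" "s \<le> e\<^sup>2 / (2 + C ^ 3)" unfolding s_def by simp_all
      then show "s * C \<le> 1/2" "s * (2 + C ^ 3) \<le> e\<^sup>2"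
        using C(1) p by (simp_all add: field_simps)
    qed
    have s2: "s\<^sup>2 > 0" using s(1) by simp
    obtain e0 where e0: "e0 > 0" "\<And>x. small e0 x \<Longrightarrow> inner (T x) x < t + s\<^sup>2"
      using above[OF s2] by blast
    \<comment> \<open>the passage from \<open>x\<close> to the normalised \<open>y\<close> loses a factor at most \<open>3\<close>: \<open>3/2\<close> from the move, \<open>2\<close> from \<open>1 / |y|\<close>\<close>
    define e1 where "e1 = min e (e0 / 3)"
    have e1: "e1 > 0" "e1 \<le> e" "3 * e1 \<le> e0" using e e0(1) by (auto simp: e1_def)
    obtain x where x: "small e1 x" "t - s\<^sup>2 \<le> inner (T x) x" using below[OF s2 e1(1)] by blast
    have nx: "norm x = 1" using x(1) by (simp add: small_def)
    \<comment> \<open>\<open>x\<close> is nearly maximal: normalising \<open>y\<close> gives a value of the form at most \<open>2 s\<^sup>2\<close> higher\<close>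
    define y where "y = x + s *\<^sub>R U x"
    have nU: "norm (s *\<^sub>R U x) \<le> 1/2"
    proof -
      have "s * norm (U x) \<le> s * C" using C(2)[of x] nx s(1) by (intro mult_left_mono) auto
      moreover have "norm (s *\<^sub>R U x) = s * norm (U x)" using s(1) by simp
      ultimately show ?thesis using s(2) by linarith
    qed
    have ny: "1/2 \<le> norm y" "norm y \<le> 3/2"
      using nU nx norm_triangle_ineq[of x "s *\<^sub>R U x"] norm_diff_ineq[of x "s *\<^sub>R U x"]
      unfolding y_def by linarith+
    have "small e0 ((1 / norm y) *\<^sub>R y)"
      unfolding small_def
    proof (intro conjI ballI)
      show "norm ((1 / norm y) *\<^sub>R y) = 1" using ny(1) by auto
      fix G assume G: "G \<in> \<G>"
      have "norm (G y) \<le> norm (G x) + s * norm (U (G x))"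
        unfolding y_def linear_add[OF lin[OF G]] linear_scale[OF lin[OF G]] GU[OF G]
        using norm_triangle_ineq[of "G x" "s *\<^sub>R U (G x)"] s(1) by simp
      also have "\<dots> \<le> norm (G x) + s * (C * norm (G x))"
        using mult_left_mono[OF C(2)[of "G x"], of s] s(1) by simp
      also have "\<dots> \<le> norm (G x) + 1/2 * norm (G x)"
        using mult_right_mono[OF s(2), of "norm (G x)"] by (simp add: mult.assoc)
      also have "\<dots> \<le> 3/2 * e1" using x(1) G by (auto simp: small_def)
      finally have "norm (G y) \<le> 3/2 * e1" .
      also have "\<dots> \<le> 3 * e1 * norm y" using ny(1) e1(1) by simp
      also have "\<dots> \<le> e0 * norm y" using e1(3) by (simp add: mult_right_mono)
      finally have Gy: "norm (G y) \<le> e0 * norm y" .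
      have "norm y > 0" using ny(1) by linarith
      with Gy show "norm (G ((1 / norm y) *\<^sub>R y)) \<le> e0"
        unfolding linear_scale[OF lin[OF G]] by (simp add: divide_le_eq)
    qed
    from e0(2)[OF this] have "inner (T y) y / (norm y)\<^sup>2 < t + s\<^sup>2"
      unfolding linear_scale[OF Tl] by (simp add: power2_eq_square)
    moreover have "(norm y)\<^sup>2 > 0" using ny(1) by auto
    ultimately have "inner (T y) y < (t + s\<^sup>2) * (norm y)\<^sup>2" by (simp add: divide_less_eq)
    then have up: "inner (U y) y < s\<^sup>2 * (norm y)\<^sup>2"
      unfolding U_def by (simp add: inner_simps power2_norm_eq_inner algebra_simps)
    have "s\<^sup>2 * (norm y)\<^sup>2 \<le> s\<^sup>2 * (9/4)"
      using power_mono[OF ny(2), of 2] ny(1) by (intro mult_left_mono) (auto simp: power2_eq_square)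
    with up have up: "inner (U y) y \<le> s\<^sup>2 * (9/4)" by linarith
    have low: "- s\<^sup>2 \<le> inner (U x) x"
      using x(2) nx by (simp add: U_def inner_simps power2_norm_eq_inner[symmetric])
    have cub: "\<bar>inner (U (U x)) (U x)\<bar> \<le> C ^ 3"
    proof -
      have a: "norm (U x) \<le> C" using C(2)[of x] nx by simp
      have "\<bar>inner (U (U x)) (U x)\<bar> \<le> norm (U (U x)) * norm (U x)" by (rule Cauchy_Schwarz_ineq2)
      also have "\<dots> \<le> (C * C) * C"
        by (intro mult_mono a order_trans[OF C(2)[of "U x"]])
           (use C(1) a in \<open>auto intro: mult_left_mono\<close>)
      finally show ?thesis by (simp add: power3_eq_cube)
    qed
    have UU: "inner (U (U x)) x = (norm (U x))\<^sup>2" by (simp add: Uself power2_norm_eq_inner)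
    have "inner (U y) y = inner (U x) x + 2 * s * (norm (U x))\<^sup>2 + s\<^sup>2 * inner (U (U x)) (U x)"
      unfolding y_def linear_add[OF Ul] linear_scale[OF Ul]
      by (simp add: inner_simps UU dot_square_norm power2_eq_square[of s] algebra_simps)
    moreover have "- (s\<^sup>2 * C ^ 3) \<le> s\<^sup>2 * inner (U (U x)) (U x)"
      using mult_left_mono[of "- (C ^ 3)" "inner (U (U x)) (U x)" "s\<^sup>2"] cub by (simp add: abs_le_iff)
    ultimately have "2 * s * (norm (U x))\<^sup>2 \<le> s\<^sup>2 * (4 + C ^ 3)"
      using up low zero_le_power2[of s] unfolding distrib_left by linarith
    also have "\<dots> \<le> 2 * s * (s * (2 + C ^ 3))"
      using s(1) C(1) by (simp add: power2_eq_square algebra_simps)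
    also have "\<dots> \<le> 2 * s * e\<^sup>2" using s(1,3) by (intro mult_left_mono) auto
    finally have "(norm (U x))\<^sup>2 \<le> e\<^sup>2" using s(1) by simp
    then have "norm (U x) \<le> e" by (rule power2_le_imp_le) (use e in simp)
    then show "\<exists>x. norm x = 1 \<and> (\<forall>G\<in>insert U \<G>. norm (G x) \<le> e)"
      using x(1) e1(2) unfolding small_def by (auto intro!: exI[of _ x] intro: order_trans)
  qed
  moreover have "inner (T x) x \<le> t" if x: "norm x = 1" "\<And>G. G \<in> \<G> \<Longrightarrow> G x = 0" for x
  proof -
    have "norm (G x) \<le> e" if "e > 0" "G \<in> \<G>" for e G
      using x(2)[OF that(2)] that(1) by simp
    then have "small e x" if "e > 0" for e using x(1) that by (simp add: small_def)
    then have "inner (T x) x \<in> Lo" unfolding Lo_def by blast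
    then show ?thesis unfolding t_def by (rule cSup_upper[OF _ bdd])
  qed
  ultimately show ?thesis using that unfolding U_def by blast
qed

definition approx_eigen :: "(nat \<Rightarrow> 'h::complex_inner) \<Rightarrow> ('h \<Rightarrow> 'h) \<Rightarrow> complex \<Rightarrow> bool" where
  "approx_eigen y T c \<longleftrightarrow> (\<lambda>k. T (y k) - c *\<^sub>C y k) \<longlonglongrightarrow> 0"

lemma approx_eigen_id: "approx_eigen y (\<lambda>x. x) 1"
  by (simp add: approx_eigen_def scaleC_one)

lemma approx_eigen_zero: "approx_eigen y (\<lambda>x. 0) 0"
  by (simp add: approx_eigen_def scaleC_zero_left)

lemma approx_eigen_scaled:
  assumes "approx_eigen y T c"
  shows "approx_eigen y (\<lambda>x. d *\<^sub>C T x) (d * c)"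
  using bounded_linear.tendsto_zero[OF bounded_linear_scaleC assms[unfolded approx_eigen_def], of d]
  by (simp add: approx_eigen_def scaleC_simps)

lemma approx_eigen_add:
  assumes "approx_eigen y S c" "approx_eigen y T d"
  shows "approx_eigen y (\<lambda>x. S x + T x) (c + d)"
  using tendsto_add_zero[OF assms[unfolded approx_eigen_def]]
  by (simp add: approx_eigen_def scaleC_simps algebra_simps)

lemma approx_eigen_compose:
  assumes S: "bounded_clinear S" and "approx_eigen y S c" "approx_eigen y T d"
  shows "approx_eigen y (\<lambda>x. S (T x)) (c * d)"
proof -
  have "(\<lambda>k. S (T (y k) - d *\<^sub>C y k) + d *\<^sub>C (S (y k) - c *\<^sub>C y k)) \<longlonglongrightarrow> 0"
    using assms(2,3) unfolding approx_eigen_def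
    by (intro tendsto_add_zero bounded_linear.tendsto_zero[OF bounded_linear_scaleC]
        bounded_linear.tendsto_zero[OF bounded_clinear_bounded_linear[OF S]])
  then show ?thesis
    by (simp add: approx_eigen_def bounded_clinear_simps[OF S] scaleC_simps mult.commute)
qed

lemma approx_eigen_sum:
  "(\<And>i. i \<in> I \<Longrightarrow> approx_eigen y (T i) (c i)) \<Longrightarrow>
    approx_eigen y (\<lambda>x. \<Sum>i\<in>I. T i x) (\<Sum>i\<in>I. c i)"
  by (induction I rule: infinite_finite_induct) (simp_all add: approx_eigen_zero approx_eigen_add)

lemma approx_eigen_funpow:
  fixes T :: "'h::complex_inner \<Rightarrow> 'h"
  assumes "bounded_clinear T" "approx_eigen y T c"
  shows "approx_eigen y (T ^^ n) (c ^ n)"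
proof (induction n)
  case 0
  show ?case by (simp add: id_def approx_eigen_id)
next
  case (Suc n)
  show ?case using approx_eigen_compose[OF assms Suc] by (simp add: comp_def)
qed

text \<open>Approximate eigenvectors obey the functional calculus of polynomials, as exact ones do.\<close>

lemma approx_eigen_op_poly3:
  assumes T: "bounded_clinear T1" "bounded_clinear T2" "bounded_clinear T3"
    and "approx_eigen y T1 c1" "approx_eigen y T2 c2" "approx_eigen y T3 c3"
  shows "approx_eigen y (op_poly3 p T1 T2 T3) (eval_poly3 p (c1, c2, c3))"
proof -
  have "approx_eigen y (\<lambda>x. (T1 ^^ i) ((T2 ^^ j) ((T3 ^^ k) x))) (c1 ^ i * (c2 ^ j * c3 ^ k))" for i j k
    using assms by (intro approx_eigen_compose approx_eigen_funpow bounded_clinear_funpow)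
  then have "approx_eigen y (\<lambda>x. d *\<^sub>C (T1 ^^ i) ((T2 ^^ j) ((T3 ^^ k) x))) (d * c1 ^ i * c2 ^ j * c3 ^ k)"
    for d i j k
    using approx_eigen_scaled[of y _ _ d] by (simp add: mult.assoc)
  then show ?thesis
    unfolding op_poly3_def eval_poly3_def prod.case
    by (intro approx_eigen_sum) (simp add: case_prod_unfold)
qed

lemma approx_eigen_cinner:
  assumes "approx_eigen y T c" and y: "\<And>k. norm (y k) = 1"
  shows "(\<lambda>k. cinner (T (y k)) (y k)) \<longlonglongrightarrow> c"
proof -
  have "(\<lambda>k. cinner (T (y k) - c *\<^sub>C y k) (y k)) \<longlonglongrightarrow> 0"
  proof (rule Lim_null_comparison)
    show "(\<lambda>k. norm (T (y k) - c *\<^sub>C y k)) \<longlonglongrightarrow> 0"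
      using assms(1) by (simp add: approx_eigen_def tendsto_norm_zero)
    show "\<forall>\<^sub>F k in sequentially. cmod (cinner (T (y k) - c *\<^sub>C y k) (y k)) \<le> norm (T (y k) - c *\<^sub>C y k)"
      using norm_cinner_le[of _ "y _"] by (auto simp: y intro!: always_eventually)
  qed
  then have "(\<lambda>k. cinner (T (y k)) (y k) - c) \<longlonglongrightarrow> 0"
    by (simp add: cinner_diff_left cinner_scaleC_left cinner_self y)
  then show ?thesis by (simp add: LIM_zero_iff)
qed

lemma approx_eigen_norm:
  assumes "approx_eigen y T c" and y: "\<And>k. norm (y k) = 1"
  shows "(\<lambda>k. norm (T (y k))) \<longlonglongrightarrow> cmod c"
proof -
  have "(\<lambda>k. norm (T (y k)) - cmod c) \<longlonglongrightarrow> 0"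
  proof (rule Lim_null_comparison)
    show "(\<lambda>k. norm (T (y k) - c *\<^sub>C y k)) \<longlonglongrightarrow> 0"
      using assms(1) by (simp add: approx_eigen_def tendsto_norm_zero)
    show "\<forall>\<^sub>F k in sequentially. norm (norm (T (y k)) - cmod c) \<le> norm (T (y k) - c *\<^sub>C y k)"
      using norm_triangle_ineq3[of "T (y _)" "c *\<^sub>C y _"]
      by (intro always_eventually allI) (metis norm_scaleC y mult.right_neutral real_norm_def)
  qed
  then show ?thesis by (simp add: LIM_zero_iff)
qed

lemma bounded_clinear_scaleR: "bounded_clinear T \<Longrightarrow> T (r *\<^sub>R x) = r *\<^sub>R T x"
  by (simp add: scaleR_scaleC bounded_clinear_scaleC)

lemma approx_kernelE:
  assumes "approx_kernel \<G>"
  obtains y where "\<And>k. norm (y k) = 1" "\<And>G. G \<in> \<G> \<Longrightarrow> (\<lambda>k. G (y k)) \<longlonglongrightarrow> 0"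
proof -
  have "\<exists>x. norm x = 1 \<and> (\<forall>G\<in>\<G>. norm (G x) \<le> inverse (Suc k))" for k
    using assms by (simp add: approx_kernel_def)
  then obtain y where y: "\<And>k. norm (y k) = 1" "\<And>k G. G \<in> \<G> \<Longrightarrow> norm (G (y k)) \<le> inverse (Suc k)"
    by metis
  have "(\<lambda>k. G (y k)) \<longlonglongrightarrow> 0" if "G \<in> \<G>" for G
    by (rule Lim_null_comparison[OF always_eventually LIMSEQ_inverse_real_of_nat]) (use y(2) that in blast)
  then show ?thesis using y(1) that by blast
qed

text \<open>A substitute for the spectral theorem.  Apply \<open>approx_kernel_eigenvalue\<close> successively to \<open>B\<^sup>* B\<close>,
  to the real part and to the imaginary part of \<open>N\<close>; all three commute.  The first step starts from the empty
  family, where the eigenvalue found dominates the whole form, hence equals \<open>|B|\<^sup>2\<close>; the other two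
  turn the vectors into joint approximate eigenvectors of \<open>N\<close> and \<open>N\<^sup>*\<close>.\<close>

lemma approx_eigen_bound_commuting:
  fixes N :: "'h::chilbert_space \<Rightarrow> 'h"
  assumes N: "bounded_clinear N" and NN': "adjoint_pair N N'"
    and normal: "\<And>x. N (N' x) = N' (N x)"
    and B: "bounded_clinear B"
    and BN: "\<And>x. B (N x) = N (B x)" and BN': "\<And>x. B (N' x) = N' (B x)"
    and ne: "norm (u :: 'h) = 1"
  obtains y lam where "\<And>k. norm (y k) = 1" "approx_eigen y N lam" "approx_eigen y N' (cnj lam)"
    "\<And>c x. approx_eigen y B c \<Longrightarrow> norm (B x) \<le> cmod c * norm x"
proof -
  have N': "bounded_clinear N'" by (rule bounded_clinear_adjoint[OF N NN'])
  define B' where "B' = adj B"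
  have BB': "adjoint_pair B B'" unfolding B'_def by (rule adjoint_pair_adj[OF B])
  have B': "bounded_clinear B'" by (rule bounded_clinear_adjoint[OF B BB'])
  note adjs = adjoint_pairD[OF NN'] adjoint_pairD[OF BB']
    adjoint_pairD[OF adjoint_pair_sym[OF NN']] adjoint_pairD[OF adjoint_pair_sym[OF BB']]
  have B'N: "B' (N x) = N (B' x)" and B'N': "B' (N' x) = N' (B' x)" for x
    by (rule cinner_ext, simp add: adjs BN BN')+
  define T where "T x = B' (B x)" for x
  define R where "R x = (1/2) *\<^sub>R (N x + N' x)" for x
  define I where "I x = (- \<i> / 2) *\<^sub>C (N x - N' x)" for x
  note lin = bounded_clinear_simps[OF N] bounded_clinear_simps[OF N'] bounded_clinear_simps[OF B]
    bounded_clinear_simps[OF B'] bounded_clinear_scaleR[OF N] bounded_clinear_scaleR[OF N']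
    bounded_clinear_scaleR[OF B] bounded_clinear_scaleR[OF B']
  have bT: "bounded_clinear T" unfolding T_def by (rule bounded_clinear_compose[OF B' B])
  have bR: "bounded_clinear R"
    unfolding R_def scaleR_scaleC by (intro bounded_clinear_scaled bounded_clinear_plus N N')
  have bI: "bounded_clinear I"
    unfolding I_def by (intro bounded_clinear_scaled bounded_clinear_minus N N')
  have sT: "inner (T x) y = inner x (T y)" and sR: "inner (R x) y = inner x (R y)"
    and sI: "inner (I x) y = inner x (I y)" for x y
    unfolding T_def R_def I_def inner_eq_Re_cinner scaleR_scaleC
    by (simp_all add: adjs cinner_simps algebra_simps)
  have TR: "T (R x) = R (T x)" and TI: "T (I x) = I (T x)" and RI: "R (I x) = I (R x)" for x
    unfolding T_def R_def I_def
    by (simp_all add: lin BN BN' B'N B'N' normal scaleR_scaleC scaleC_simps)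
  have shift: "linear (\<lambda>x. S x - r *\<^sub>R x)" if "bounded_clinear S" for S :: "'h \<Rightarrow> 'h" and r
    by (rule bounded_linear.linear)
       (intro bounded_linear_sub bounded_clinear_bounded_linear[OF that] bounded_linear_scaleR_right)
  note bl = bounded_clinear_bounded_linear
  have "approx_kernel ({} :: ('h \<Rightarrow> 'h) set)" using ne by (auto simp: approx_kernel_def)
  then obtain t where t: "approx_kernel {\<lambda>x. T x - t *\<^sub>R x}"
      and form: "\<And>x. norm x = 1 \<Longrightarrow> inner (T x) x \<le> t"
    by (rule approx_kernel_eigenvalue[OF bl[OF bT] sT, rotated 2]) auto
  obtain a where a: "approx_kernel {\<lambda>x. R x - a *\<^sub>R x, \<lambda>x. T x - t *\<^sub>R x}"
    by (rule approx_kernel_eigenvalue[OF bl[OF bR] sR _ _ t])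
       (auto simp: shift[OF bT] TR bounded_clinear_diff[OF bR] bounded_clinear_scaleR[OF bR])
  obtain b where b: "approx_kernel {\<lambda>x. I x - b *\<^sub>R x, \<lambda>x. R x - a *\<^sub>R x, \<lambda>x. T x - t *\<^sub>R x}"
    by (rule approx_kernel_eigenvalue[OF bl[OF bI] sI _ _ a])
       (auto simp: shift[OF bT] shift[OF bR] TI RI bounded_clinear_diff[OF bI] bounded_clinear_scaleR[OF bI])
  obtain y where y: "\<And>k. norm (y k) = 1"
    and lim: "(\<lambda>k. I (y k) - b *\<^sub>R y k) \<longlonglongrightarrow> 0" "(\<lambda>k. R (y k) - a *\<^sub>R y k) \<longlonglongrightarrow> 0"
      "(\<lambda>k. T (y k) - t *\<^sub>R y k) \<longlonglongrightarrow> 0"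
    by (rule approx_kernelE[OF b]) force
  have eig: "approx_eigen y I b" "approx_eigen y R a" "approx_eigen y T t"
    using lim by (simp_all add: approx_eigen_def scaleR_scaleC)
  have N_eq: "N = (\<lambda>x. R x + \<i> *\<^sub>C I x)" "N' = (\<lambda>x. R x + (- \<i>) *\<^sub>C I x)"
    by (auto simp: R_def I_def scaleR_scaleC scaleC_simps algebra_simps fun_eq_iff
        scaleC_add_left[symmetric])
  have "approx_eigen y N (a + \<i> * b)" "approx_eigen y N' (a + (- \<i>) * b)"
    by (subst N_eq, intro approx_eigen_add approx_eigen_scaled eig)+
  then have "approx_eigen y N (Complex a b)" "approx_eigen y N' (cnj (Complex a b))"
    by (simp_all only: Complex_eq complex_cnj_add complex_cnj_mult complex_cnj_i complex_cnj_complex_of_real)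
  moreover have "norm (B x) \<le> cmod c * norm x" if c: "approx_eigen y B c" for c x
  proof -
    have TB: "inner (T x) x = (norm (B x))\<^sup>2" for x
      by (simp add: T_def inner_eq_Re_cinner adjs cinner_self)
    have "(\<lambda>k. complex_of_real ((norm (B (y k)))\<^sup>2)) \<longlonglongrightarrow> complex_of_real t"
      using approx_eigen_cinner[OF eig(3) y] by (simp add: T_def adjs cinner_self)
    then have "(\<lambda>k. (norm (B (y k)))\<^sup>2) \<longlonglongrightarrow> t" by (simp only: tendsto_of_real_iff)
    moreover have "(\<lambda>k. (norm (B (y k)))\<^sup>2) \<longlonglongrightarrow> (cmod c)\<^sup>2"
      by (intro tendsto_power approx_eigen_norm[OF c y])
    ultimately have t: "t = (cmod c)\<^sup>2" by (rule LIMSEQ_unique)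
    show ?thesis
    proof (cases "x = 0")
      case False
      then have "inner (T (sgn x)) (sgn x) \<le> (cmod c)\<^sup>2" using form[of "sgn x"] t by (simp add: norm_sgn)
      then have "norm (B (sgn x)) \<le> cmod c" unfolding TB by (rule power2_le_imp_le) simp
      then show ?thesis
        using False by (simp add: sgn_div_norm bounded_clinear_scaleR[OF B] field_simps)
    qed (simp add: lin)
  qed
  ultimately show ?thesis using that[of y "Complex a b"] y by blast
qed

section \<open>The tetrablock\<close>

text \<open>A point satisfying the condition on the open bidisc only is the limit, as \<open>r\<close> tends to \<open>1\<close>, of the points
  \<open>(r x1, r x2, r\<^sup>2 x3)\<close>, which satisfy it on the closed bidisc: the factors \<open>r\<close> can be moved to
  \<open>z\<close> and \<open>w\<close>.\<close>

lemma closure_tetrablockI: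
  assumes "\<And>z w. cmod z < 1 \<Longrightarrow> cmod w < 1 \<Longrightarrow> 1 - z * x1 - w * x2 + z * w * x3 \<noteq> 0"
  shows "(x1, x2, x3) \<in> closure tetrablock"
proof -
  define r where "r n = complex_of_real (1 - inverse (real (Suc n)))" for n
  have r: "cmod (r n) < 1" for n
  proof -
    have "0 < inverse (real (Suc n))" "inverse (real (Suc n)) \<le> 1"
      by (simp_all add: inverse_le_1_iff)
    then show ?thesis unfolding r_def norm_of_real by simp
  qed
  have "(r n * x1, r n * x2, r n * r n * x3) \<in> tetrablock" for n
    unfolding tetrablock_def
  proof (clarify)
    fix z w :: complex
    assume zw: "cmod z \<le> 1" "cmod w \<le> 1"
      and 0: "1 - z * (r n * x1) - w * (r n * x2) + z * w * (r n * r n * x3) = 0"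
    have "cmod (z * r n) < 1" "cmod (w * r n) < 1"
      using zw r[of n] by (simp_all add: norm_mult mult_le_less_imp_less
        mult_left_le_one_le order_le_less_trans[OF mult_left_le_one_le])
    from assms[OF this] 0 show False by (simp add: algebra_simps)
  qed
  moreover have "r \<longlonglongrightarrow> 1"
  proof -
    have "(\<lambda>n. 1 - inverse (real (Suc n))) \<longlonglongrightarrow> 1 - 0"
      by (intro tendsto_diff tendsto_const LIMSEQ_inverse_real_of_nat)
    from tendsto_of_real[OF this, where 'a = complex] show ?thesis by (simp add: r_def[abs_def])
  qed
  then have "(\<lambda>n. (r n * x1, r n * x2, r n * r n * x3)) \<longlonglongrightarrow> (1 * x1, 1 * x2, 1 * 1 * x3)"
    by (intro tendsto_intros)
  ultimately show ?thesis
    unfolding closure_sequential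
    by (intro exI[of _ "\<lambda>n. (r n * x1, r n * x2, r n * r n * x3)"]) simp
qed

lemma blaschke_identity:
  "(cmod (1 - z * cnj l))\<^sup>2 - (cmod (l - z))\<^sup>2 = (1 - (cmod z)\<^sup>2) * (1 - (cmod l)\<^sup>2)"
proof -
  have "complex_of_real ((cmod (1 - z * cnj l))\<^sup>2 - (cmod (l - z))\<^sup>2)
      = complex_of_real ((1 - (cmod z)\<^sup>2) * (1 - (cmod l)\<^sup>2))"
    unfolding of_real_diff of_real_mult of_real_1 complex_norm_square by (simp add: algebra_simps)
  then show ?thesis by (simp only: of_real_eq_iff)
qed

text \<open>With \<open>a = z u\<close>, the defining polynomial is \<open>(1 - a l\<^sup>*) - w (l - a)\<close>, and
  \<open>(l - a) / (1 - a l\<^sup>*)\<close> has modulus at most one because \<open>a\<close> and \<open>l\<close> lie in the disc.\<close>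

lemma distinguished_boundary_in_closure:
  assumes l: "cmod l \<le> 1" and u: "cmod u = 1"
  shows "(u * cnj l, l, u) \<in> closure tetrablock"
proof (rule closure_tetrablockI)
  fix z w assume z: "cmod z < 1" and w: "cmod w < 1"
  define a where "a = z * u"
  have a: "cmod a < 1" using z u by (simp add: a_def norm_mult)
  have "cmod (a * cnj l) < 1"
    using a l mult_right_le_one_le[of "cmod a" "cmod l"] by (simp add: norm_mult)
  then have pos: "cmod (1 - a * cnj l) > 0" by (metis eq_iff_diff_eq_0 norm_one less_irrefl zero_less_norm_iff)
  have "0 \<le> (1 - (cmod a)\<^sup>2) * (1 - (cmod l)\<^sup>2)"
    using a l by (intro mult_nonneg_nonneg) (auto simp: power_le_one)
  then have "(cmod (l - a))\<^sup>2 \<le> (cmod (1 - a * cnj l))\<^sup>2" using blaschke_identity[of a l] by linarith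
  then have le: "cmod (l - a) \<le> cmod (1 - a * cnj l)" by (rule power2_le_imp_le) simp
  have "cmod (w * (l - a)) < cmod (1 - a * cnj l)"
  proof (cases "l = a")
    case False
    then have "cmod w * cmod (l - a) < 1 * cmod (l - a)" using w by (intro mult_strict_right_mono) auto
    then show ?thesis using le by (simp add: norm_mult)
  qed (use pos in simp)
  moreover have "1 - z * (u * cnj l) - w * l + z * w * u = (1 - a * cnj l) - w * (l - a)"
    by (simp add: a_def algebra_simps)
  ultimately show "1 - z * (u * cnj l) - w * l + z * w * u \<noteq> 0" by (metis eq_iff_diff_eq_0 less_irrefl)
qed

lemma norm_less_if_no_zero:
  assumes "\<And>z. cmod z \<le> 1 \<Longrightarrow> a - z * b \<noteq> 0"
  shows "cmod b \<le> cmod a"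
proof (rule ccontr)
  assume "\<not> cmod b \<le> cmod a"
  then have "cmod a < cmod b" by simp
  then have "b \<noteq> 0" "cmod (a / b) \<le> 1" by (auto simp: norm_divide divide_le_eq_1)
  then show False using assms[of "a / b"] by simp
qed

lemma bounded_tetrablock: "bounded tetrablock"
proof (rule boundedI)
  fix x assume "x \<in> tetrablock"
  then obtain x1 x2 x3 where x: "x = (x1, x2, x3)"
    and nz: "\<And>z w. cmod z \<le> 1 \<Longrightarrow> cmod w \<le> 1 \<Longrightarrow> 1 - z * x1 - w * x2 + z * w * x3 \<noteq> 0"
    by (auto simp: tetrablock_def)
  have "cmod x1 \<le> cmod 1" "cmod x2 \<le> cmod 1"
    by (rule norm_less_if_no_zero, use nz[of _ 0] nz[of 0] in simp)+
  moreover have "cmod (x2 - x3) \<le> cmod (1 - x1)"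
    by (rule norm_less_if_no_zero) (use nz[of 1] in \<open>simp add: algebra_simps\<close>)
  ultimately have "cmod x1 \<le> 1" "cmod x2 \<le> 1" "cmod x3 \<le> 3"
    using norm_triangle_ineq4[of 1 x1] norm_triangle_ineq2[of x3 x2]
    by (simp_all add: norm_minus_commute)
  then show "norm x \<le> 5"
    unfolding x using norm_Pair_le[of x1 "(x2, x3)"] norm_Pair_le[of x2 x3] by linarith
qed

lemma cmod_eval_poly3_le_Sup:
  assumes "x \<in> closure tetrablock"
  shows "cmod (eval_poly3 p x) \<le> (SUP x\<in>closure tetrablock. cmod (eval_poly3 p x))"
proof (rule cSUP_upper[OF assms])
  have "compact (closure tetrablock)" by (simp add: compact_closure bounded_tetrablock)
  moreover have "continuous_on (closure tetrablock) (\<lambda>x. cmod (eval_poly3 p x))"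
    unfolding eval_poly3_def case_prod_unfold by (intro continuous_intros)
  ultimately show "bdd_above ((\<lambda>x. cmod (eval_poly3 p x)) ` closure tetrablock)"
    by (intro bounded_imp_bdd_above compact_imp_bounded compact_continuous_image)
qed

section \<open>Normal operators with numerical radius at most one\<close>

lemma cmod_cinner_le_numerical_radius:
  assumes T: "bounded_clinear T" and x: "norm x = 1"
  shows "cmod (cinner (T x) x) \<le> numerical_radius T"
  unfolding numerical_radius_def
proof (rule cSup_upper)
  obtain K where K: "K > 0" "\<And>x. norm (T x) \<le> K * norm x"
    using T by (rule bounded_clinear_boundedE) blast
  have "cmod (cinner (T x) x) \<le> K" if "norm x = 1" for x
    using norm_cinner_le[of "T x" x] K(2)[of x] that by simp
  then show "bdd_above (insert 0 {cmod (cinner (T x) x) |x. norm x = 1})"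
    using K(1) by (intro bdd_aboveI[of _ K]) auto
qed (use x in auto)

text \<open>Turns a bound on \<open>|a + z b|\<close> for all unimodular \<open>z\<close> into one on \<open>|a| + |b|\<close>.\<close>

lemma unimodular_aligning: "\<exists>z. cmod z = 1 \<and> cmod (a + z * b) = cmod a + cmod b"
proof (cases "a = 0 \<or> b = 0")
  case True
  then show ?thesis by (intro exI[of _ 1]) auto
next
  case False
  have "b * cnj (sgn b) = complex_of_real (cmod b)" "a = sgn a * complex_of_real (cmod a)"
    using False complex_norm_square[of b]
    by (simp_all add: sgn_div_norm scaleR_conv_of_real field_simps power2_eq_square)
  then have "a + (sgn a * cnj (sgn b)) * b = sgn a * complex_of_real (cmod a + cmod b)"
    by (simp add: algebra_simps)
  then have "cmod (a + (sgn a * cnj (sgn b)) * b) = cmod (sgn a) * \<bar>cmod a + cmod b\<bar>"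
    by (simp only: norm_mult norm_of_real)
  then show ?thesis
    using False by (intro exI[of _ "sgn a * cnj (sgn b)"]) (simp add: norm_mult norm_sgn)
qed

text \<open>In this form the hypothesis on numerical radii is insensitive to replacing \<open>A1\<close> by its adjoint,
  as will be needed for the symbol \<open>A2 + u A1\<^sup>*\<close>.\<close>

lemma pencil_quadratic_forms_le:
  assumes A: "bounded_clinear A1" "bounded_clinear A2"
    and rad: "\<And>z. cmod z = 1 \<Longrightarrow> numerical_radius (\<lambda>x. A1 x + z *\<^sub>C A2 x) \<le> 1"
    and x: "norm x = 1"
  shows "cmod (cinner (A1 x) x) + cmod (cinner (A2 x) x) \<le> 1"
proof -
  obtain z where z: "cmod z = 1"
    "cmod (cinner (A1 x) x + z * cinner (A2 x) x) = cmod (cinner (A1 x) x) + cmod (cinner (A2 x) x)"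
    using unimodular_aligning by blast
  have "bounded_clinear (\<lambda>x. A1 x + z *\<^sub>C A2 x)"
    by (intro bounded_clinear_plus bounded_clinear_scaled A)
  from cmod_cinner_le_numerical_radius[OF this x] rad[OF z(1)] z(2)
  show ?thesis by (simp add: cinner_simps)
qed

lemma funpow_commute:
  fixes T :: "'h \<Rightarrow> 'h"
  assumes "\<And>x. T (N x) = N (T x)"
  shows "(T ^^ n) (N x) = N ((T ^^ n) x)"
  by (induction n) (simp_all add: assms)

lemma op_poly3_commute:
  assumes "bounded_clinear N" "\<And>x. T1 (N x) = N (T1 x)" "\<And>x. T2 (N x) = N (T2 x)"
    "\<And>x. T3 (N x) = N (T3 x)"
  shows "op_poly3 p T1 T2 T3 (N x) = N (op_poly3 p T1 T2 T3 x)"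
  unfolding op_poly3_def using assms
  by (simp add: bounded_clinear_simps case_prod_unfold funpow_commute)

lemma adjoint_pair_normal_norm:
  assumes "adjoint_pair N N'" "\<And>x. N (N' x) = N' (N x)"
  shows "norm (N' x) = norm (N x)"
proof -
  have "complex_of_real ((norm (N' x))\<^sup>2) = complex_of_real ((norm (N x))\<^sup>2)"
    by (metis assms(2) adjoint_pairD[OF assms(1)] adjoint_pairD[OF adjoint_pair_sym[OF assms(1)]] cinner_self)
  then have "(norm (N' x))\<^sup>2 = (norm (N x))\<^sup>2" by (simp only: of_real_eq_iff)
  then show ?thesis by simp
qed

context
  fixes N N' :: "'h::chilbert_space \<Rightarrow> 'h"
  assumes N: "bounded_clinear N" and NN': "adjoint_pair N N'"
    and normal: "\<And>x. N (N' x) = N' (N x)"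
    and form: "\<And>x. norm x = 1 \<Longrightarrow> cmod (cinner (N x) x) \<le> 1"
begin

text \<open>The function \<open>q\<close> plays the part of \<open>B\<close> in the functional calculus of \<open>N\<close>.  Only values on
  the closed disc matter, since an approximate eigenvalue of \<open>N\<close> is a limit of values of its quadratic form.\<close>

lemma norm_le_of_symbol:
  assumes B: "bounded_clinear B"
    and BN: "\<And>x. B (N x) = N (B x)" and BN': "\<And>x. B (N' x) = N' (B x)"
    and sym: "\<And>y l. approx_eigen y N l \<Longrightarrow> approx_eigen y N' (cnj l) \<Longrightarrow> approx_eigen y B (q l)"
    and q: "\<And>l. cmod l \<le> 1 \<Longrightarrow> cmod (q l) \<le> M"
  shows "norm (B x) \<le> M * norm x"
proof (cases "x = 0")
  case False
  then have u: "norm (sgn x) = 1" by (simp add: norm_sgn)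
  obtain y l where y: "\<And>k. norm (y k) = 1" "approx_eigen y N l" "approx_eigen y N' (cnj l)"
    and le: "\<And>c x. approx_eigen y B c \<Longrightarrow> norm (B x) \<le> cmod c * norm x"
    by (rule approx_eigen_bound_commuting[OF N NN' normal B BN BN' u]) blast
  have "(\<lambda>k. cmod (cinner (N (y k)) (y k))) \<longlonglongrightarrow> cmod l"
    by (intro tendsto_norm approx_eigen_cinner y)
  then have "cmod l \<le> 1" by (rule LIMSEQ_le_const2) (use form y(1) in blast)
  then have "cmod (q l) \<le> M" by (rule q)
  then show ?thesis using le[OF sym[OF y(2,3)], of x] by (meson mult_right_mono norm_ge_zero order_trans)
qed (simp add: bounded_clinear_zero[OF B])

lemma bounded_clinear_N': "bounded_clinear N'"
  by (rule bounded_clinear_adjoint[OF N NN'])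

text \<open>Norm and numerical radius agree for normal operators: this is the case \<open>B = N\<close> of the preceding bound.\<close>

lemma norm_normal_le: "norm (N x) \<le> norm x"
  using norm_le_of_symbol[OF N refl normal, of "\<lambda>l. l" 1] by simp

lemma norm_op_poly3_normal_le:
  assumes u: "cmod u = 1"
  shows "norm (op_poly3 p (\<lambda>x. u *\<^sub>C N' x) N (\<lambda>x. u *\<^sub>C x) x)
    \<le> (SUP x\<in>closure tetrablock. cmod (eval_poly3 p x)) * norm x"
proof (rule norm_le_of_symbol)
  let ?T1 = "\<lambda>x. u *\<^sub>C N' x" and ?T3 = "\<lambda>x. u *\<^sub>C x"
  have T: "bounded_clinear ?T1" "bounded_clinear ?T3"
    by (intro bounded_clinear_scaled bounded_clinear_id bounded_clinear_N')+
  show "bounded_clinear (op_poly3 p ?T1 N ?T3)" by (intro bounded_clinear_op_poly3 T N)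
  show "op_poly3 p ?T1 N ?T3 (N x) = N (op_poly3 p ?T1 N ?T3 x)" for x
    by (rule op_poly3_commute) (simp_all add: N bounded_clinear_scaleC normal)
  show "op_poly3 p ?T1 N ?T3 (N' x) = N' (op_poly3 p ?T1 N ?T3 x)" for x
    by (rule op_poly3_commute) (simp_all add: bounded_clinear_N' bounded_clinear_scaleC normal)
  show "approx_eigen y (op_poly3 p ?T1 N ?T3) (eval_poly3 p (u * cnj l, l, u))"
    if "approx_eigen y N l" "approx_eigen y N' (cnj l)" for y l
    using approx_eigen_scaled[OF that(2), of u] approx_eigen_scaled[OF approx_eigen_id, of y u]
    by (intro approx_eigen_op_poly3 T N that) simp_all
  show "cmod (eval_poly3 p (u * cnj l, l, u)) \<le> (SUP x\<in>closure tetrablock. cmod (eval_poly3 p x))"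
    if "cmod l \<le> 1" for l
    by (intro cmod_eval_poly3_le_Sup distinguished_boundary_in_closure that u)
qed

text \<open>By normality the difference of the squares is \<open>(1 - |a|\<^sup>2) (|x|\<^sup>2 - |N x|\<^sup>2)\<close>, as for scalars.\<close>

lemma norm_blaschke_factor_le:
  assumes a: "cmod a \<le> 1"
  shows "norm (N x - a *\<^sub>C x) \<le> norm (x - a *\<^sub>C N' x)"
proof -
  have "(norm (x - a *\<^sub>C N' x))\<^sup>2 - (norm (N x - a *\<^sub>C x))\<^sup>2
      = (norm x)\<^sup>2 + (cmod a)\<^sup>2 * (norm (N' x))\<^sup>2 - (norm (N x))\<^sup>2 - (cmod a)\<^sup>2 * (norm x)\<^sup>2"
  proof -
    have "complex_of_real ((norm (x - a *\<^sub>C N' x))\<^sup>2 - (norm (N x - a *\<^sub>C x))\<^sup>2)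
      = complex_of_real ((norm x)\<^sup>2 + (cmod a)\<^sup>2 * (norm (N' x))\<^sup>2 - (norm (N x))\<^sup>2 - (cmod a)\<^sup>2 * (norm x)\<^sup>2)"
      unfolding of_real_diff of_real_add of_real_mult cinner_self[symmetric] complex_norm_square
      by (simp add: cinner_simps adjoint_pairD[OF NN'] adjoint_pairD[OF adjoint_pair_sym[OF NN']] algebra_simps)
    then show ?thesis by (simp only: of_real_eq_iff)
  qed
  also have "\<dots> = (1 - (cmod a)\<^sup>2) * ((norm x)\<^sup>2 - (norm (N x))\<^sup>2)"
    unfolding adjoint_pair_normal_norm[OF NN' normal] by (simp add: algebra_simps)
  also have "\<dots> \<ge> 0"
    using a norm_normal_le[of x] by (intro mult_nonneg_nonneg) (auto simp: power_le_one power_mono)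
  finally have "(norm (N x - a *\<^sub>C x))\<^sup>2 \<le> (norm (x - a *\<^sub>C N' x))\<^sup>2" by simp
  then show ?thesis by (rule power2_le_imp_le) simp
qed

end

section \<open>Toeplitz operators with linear symbols on the Hardy space\<close>

definition hardy_of :: "(nat \<Rightarrow> 'e::chilbert_space) \<Rightarrow> 'e hardy" where
  "hardy_of a = Abs_hardy (disc_series a)"

lemma hardy_coeff_of: "square_summable a \<Longrightarrow> hardy_coeff (hardy_of a) = a"
  unfolding hardy_of_def by (rule hardy_coeff_Abs) simp_all

lemmas hardy_coeff_simps = hardy_coeff_zero hardy_coeff_add hardy_coeff_diff hardy_coeff_scaleC

lemma square_summable_bounded:
  assumes A: "bounded_clinear A" and "square_summable a"
  shows "square_summable (\<lambda>n. A (a n))"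
proof -
  obtain K where K: "K > 0" "\<And>x. norm (A x) \<le> K * norm x"
    using A by (rule bounded_clinear_boundedE) blast
  have le: "norm ((norm (A (a n)))\<^sup>2) \<le> K\<^sup>2 * (norm (a n))\<^sup>2" for n
    using power_mono[OF K(2)[of "a n"], of 2] by (simp add: power_mult_distrib)
  have "summable (\<lambda>n. K\<^sup>2 * (norm (a n))\<^sup>2)"
    using assms(2) unfolding square_summable_def by (rule summable_mult)
  then show ?thesis
    unfolding square_summable_def by (rule summable_comparison_test'[where N = 0]) (rule le)
qed

lemma square_summable_Suc: "square_summable a \<Longrightarrow> square_summable (\<lambda>n. a (Suc n))"
  unfolding square_summable_def by (simp add: summable_Suc_iff[of "\<lambda>n. (norm (a n))\<^sup>2"])

definition delay :: "(nat \<Rightarrow> 'e::zero) \<Rightarrow> nat \<Rightarrow> 'e" where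
  "delay a n = (case n of 0 \<Rightarrow> 0 | Suc m \<Rightarrow> a m)"

lemma delay_simps [simp]: "delay a 0 = 0" "delay a (Suc n) = a n"
  by (simp_all add: delay_def)

lemma square_summable_delay: "square_summable a \<Longrightarrow> square_summable (delay a)"
  unfolding square_summable_def
  using summable_Suc_iff[of "\<lambda>n. (norm (delay a n))\<^sup>2"] by simp

text \<open>The Toeplitz operators with symbols \<open>A + cnj z B\<close> and \<open>A + z B\<close> on the unit circle.\<close>

definition coanalytic_toeplitz :: "('e \<Rightarrow> 'e) \<Rightarrow> ('e \<Rightarrow> 'e) \<Rightarrow> 'e::chilbert_space hardy \<Rightarrow> 'e hardy" where
  "coanalytic_toeplitz A B f = hardy_of (\<lambda>n. A (hardy_coeff f n) + B (hardy_coeff f (Suc n)))"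

definition analytic_toeplitz :: "('e \<Rightarrow> 'e) \<Rightarrow> ('e \<Rightarrow> 'e) \<Rightarrow> 'e::chilbert_space hardy \<Rightarrow> 'e hardy" where
  "analytic_toeplitz A B f = hardy_of (\<lambda>n. A (hardy_coeff f n) + B (delay (hardy_coeff f) n))"

context
  fixes A B :: "'e::chilbert_space \<Rightarrow> 'e"
  assumes A: "bounded_clinear A" and B: "bounded_clinear B"
begin

lemma coeff_coanalytic_toeplitz:
  "hardy_coeff (coanalytic_toeplitz A B f) n = A (hardy_coeff f n) + B (hardy_coeff f (Suc n))"
  unfolding coanalytic_toeplitz_def
  by (subst hardy_coeff_of[OF square_summable_add[OF square_summable_bounded[OF A hardy_coeff(1)]
        square_summable_bounded[OF B square_summable_Suc[OF hardy_coeff(1)]]]]) (rule refl)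

lemma coeff_analytic_toeplitz:
  "hardy_coeff (analytic_toeplitz A B f) n = A (hardy_coeff f n) + B (delay (hardy_coeff f) n)"
  unfolding analytic_toeplitz_def
  by (subst hardy_coeff_of[OF square_summable_add[OF square_summable_bounded[OF A hardy_coeff(1)]
        square_summable_bounded[OF B square_summable_delay[OF hardy_coeff(1)]]]]) (rule refl)

end

lemma cinner_hardy_sums: "(\<lambda>n. cinner (hardy_coeff f n) (hardy_coeff g n)) sums cinner f g"
  unfolding cinner_hardy_def by (intro summable_sums summable_cinner hardy_coeff)

lemma adjoint_pair_toeplitz:
  assumes A: "bounded_clinear A" "bounded_clinear A'" "adjoint_pair A A'"
    and B: "bounded_clinear B" "bounded_clinear B'" "adjoint_pair B B'"
  shows "adjoint_pair (coanalytic_toeplitz A B) (analytic_toeplitz A' B')"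
  unfolding adjoint_pair_def
proof (intro allI)
  fix f g :: "'a hardy"
  let ?f = "hardy_coeff f" and ?g = "hardy_coeff g"
  have ss: "square_summable (\<lambda>n. A (?f n))" "square_summable (\<lambda>n. B (?f (Suc n)))"
    by (rule square_summable_bounded[OF A(1) hardy_coeff(1)]
        square_summable_bounded[OF B(1) square_summable_Suc[OF hardy_coeff(1)]])+
  have s: "(\<lambda>n. cinner (A (?f n)) (?g n)) sums suminf (\<lambda>n. cinner (A (?f n)) (?g n))"
    "(\<lambda>n. cinner (B (?f (Suc n))) (?g n)) sums suminf (\<lambda>n. cinner (B (?f (Suc n))) (?g n))"
    by (intro summable_sums summable_cinner ss hardy_coeff)+
  have "(\<lambda>n. cinner (?f (Suc n)) (B' (delay ?g (Suc n)))) sums suminf (\<lambda>n. cinner (B (?f (Suc n))) (?g n))"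
    using s(2) by (simp add: adjoint_pairD[OF B(3)])
  then have "(\<lambda>n. cinner (?f n) (B' (delay ?g n))) sums suminf (\<lambda>n. cinner (B (?f (Suc n))) (?g n))"
    by (subst (asm) sums_Suc_iff) (simp add: bounded_clinear_zero[OF B(2)] cinner_zero_right)
  with s(1) have "(\<lambda>n. cinner (?f n) (hardy_coeff (analytic_toeplitz A' B' g) n)) sums
     (suminf (\<lambda>n. cinner (A (?f n)) (?g n)) + suminf (\<lambda>n. cinner (B (?f (Suc n))) (?g n)))"
    unfolding coeff_analytic_toeplitz[OF A(2) B(2)] cinner_add_right adjoint_pairD[OF A(3)]
    by (rule sums_add)
  moreover have "(\<lambda>n. cinner (hardy_coeff (coanalytic_toeplitz A B f) n) (?g n)) sums
     (suminf (\<lambda>n. cinner (A (?f n)) (?g n)) + suminf (\<lambda>n. cinner (B (?f (Suc n))) (?g n)))"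
    unfolding coeff_coanalytic_toeplitz[OF A(1) B(1)] cinner_add_left using s by (rule sums_add)
  ultimately show "cinner (coanalytic_toeplitz A B f) g = cinner f (analytic_toeplitz A' B' g)"
    using cinner_hardy_sums sums_unique2 by metis
qed

lemma norm_hardy_le:
  assumes "\<And>N. (\<Sum>n<N. (norm (hardy_coeff f n))\<^sup>2) \<le> C\<^sup>2" and "C \<ge> 0"
  shows "norm f \<le> C"
proof -
  have "(norm f)\<^sup>2 \<le> C\<^sup>2"
    using norm_hardy_sums[of f] unfolding sums_def
    by (rule LIMSEQ_le_const2) (use assms(1) in blast)
  then show ?thesis using assms(2) by (rule power2_le_imp_le)
qed

section \<open>Boundary values and Parseval's identity\<close>

definition hardy_poly :: "nat \<Rightarrow> 'e::chilbert_space hardy \<Rightarrow> bool" where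
  "hardy_poly N f \<longleftrightarrow> (\<forall>n\<ge>N. hardy_coeff f n = 0)"

text \<open>Meaningful for polynomials only; summing over the support avoids carrying a degree bound along.\<close>

definition boundary_value :: "complex \<Rightarrow> 'e::chilbert_space hardy \<Rightarrow> 'e" where
  "boundary_value u f = (\<Sum>n | hardy_coeff f n \<noteq> 0. u ^ n *\<^sub>C hardy_coeff f n)"

lemma hardy_poly_mono: "hardy_poly M f \<Longrightarrow> M \<le> N \<Longrightarrow> hardy_poly N f"
  by (simp add: hardy_poly_def)

lemma boundary_value_eq:
  assumes "hardy_poly N f"
  shows "boundary_value u f = (\<Sum>n<N. u ^ n *\<^sub>C hardy_coeff f n)"
  unfolding boundary_value_def using assms
  by (intro sum.mono_neutral_left) (auto simp: hardy_poly_def scaleC_zero_right intro: leI)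

text \<open>Orthogonality of the characters of the group of \<open>L\<close>-th roots of unity.\<close>

lemma root_of_unity_powers_orthogonal:
  assumes kl: "k < L" "l < L"
  defines "v \<equiv> cis (2 * pi / L)"
  shows "(\<Sum>j<L. (v ^ k * cnj (v ^ l)) ^ j) = (if k = l then of_nat L else 0)"
proof -
  have unit: "v ^ n * cnj (v ^ n) = 1" for n
    unfolding complex_norm_square[symmetric] by (simp add: v_def norm_power)
  show ?thesis
  proof (cases "k = l")
    case True
    then show ?thesis by (simp only: unit) simp
  next
    case False
    have v: "v ^ n = cis (2 * pi * real n / real L)" for n
      unfolding v_def Complex.DeMoivre by (rule arg_cong[where f = cis]) simp
    have L: "v ^ L = 1" using kl by (simp add: v)
    have "(v ^ k * cnj (v ^ l)) ^ L = (v ^ L) ^ k * cnj ((v ^ L) ^ l)"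
      by (simp only: power_mult_distrib complex_cnj_power power_mult[symmetric] mult.commute)
    then have "(v ^ k * cnj (v ^ l)) ^ L = 1" using L by simp
    moreover have "v ^ k * cnj (v ^ l) \<noteq> 1"
    proof
      assume *: "v ^ k * cnj (v ^ l) = 1"
      have "v ^ k = (v ^ k * cnj (v ^ l)) * v ^ l"
        using unit[of l] by (metis mult.assoc mult.commute mult.right_neutral)
      with * have "v ^ k = v ^ l" by simp
      moreover have "inj_on (\<lambda>n. cis (2 * pi * real n / real L)) {..<L}"
        using Complex.bij_betw_roots_unity[of L] kl by (simp add: bij_betw_def)
      ultimately show False using False kl unfolding v by (auto dest: inj_onD)
    qed
    ultimately show ?thesis using False by (simp add: geometric_sum)
  qed
qed

lemma norm_square_sum:
  "complex_of_real ((norm (\<Sum>k<N. c k *\<^sub>C a k))\<^sup>2)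
    = (\<Sum>k<N. \<Sum>l<N. (c k * cnj (c l)) * cinner (a k) (a l))"
  unfolding cinner_self[symmetric] cinner_sum_left cinner_sum_right cinner_scaleC_left
    cinner_scaleC_right sum_distrib_left
  by (subst sum.swap) (intro sum.cong refl, simp add: mult_ac)

text \<open>For polynomials of degree less than \<open>L\<close>, averaging over the \<open>L\<close>-th roots of unity is as good as
  integrating over the circle.\<close>

lemma parseval_roots_of_unity:
  fixes f :: "'e::chilbert_space hardy"
  assumes f: "hardy_poly L f"
  shows "(\<Sum>j<L. (norm (boundary_value (cis (2 * pi / L) ^ j) f))\<^sup>2) = L * (norm f)\<^sup>2"
proof -
  define v where "v = cis (2 * pi / L)"
  define a where "a = hardy_coeff f"
  have "complex_of_real (\<Sum>j<L. (norm (boundary_value (v ^ j) f))\<^sup>2)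
      = (\<Sum>j<L. \<Sum>k<L. \<Sum>l<L. ((v ^ j) ^ k * cnj ((v ^ j) ^ l)) * cinner (a k) (a l))"
    unfolding of_real_sum boundary_value_eq[OF f] a_def norm_square_sum ..
  also have "\<dots> = (\<Sum>k<L. \<Sum>l<L. (\<Sum>j<L. (v ^ k * cnj (v ^ l)) ^ j) * cinner (a k) (a l))"
  proof -
    have "(v ^ j) ^ k * cnj ((v ^ j) ^ l) = (v ^ k * cnj (v ^ l)) ^ j" for j k l
      by (simp only: power_mult_distrib complex_cnj_power power_mult[symmetric] mult.commute)
    then show ?thesis
      unfolding sum_distrib_right
      by (simp only:) (subst sum.swap, rule sum.cong[OF refl], rule sum.swap)
  qed
  also have "\<dots> = (\<Sum>k<L. \<Sum>l<L. if k = l then of_nat L * cinner (a k) (a k) else 0)"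
    unfolding v_def
    by (intro sum.cong refl, subst root_of_unity_powers_orthogonal) (simp_all split: if_split)
  also have "\<dots> = (\<Sum>k<L. of_nat L * cinner (a k) (a k))" by (simp add: sum.delta)
  also have "\<dots> = complex_of_real (L * (\<Sum>k<L. (norm (a k))\<^sup>2))"
    by (simp add: cinner_self sum_distrib_left)
  finally have "(\<Sum>j<L. (norm (boundary_value (v ^ j) f))\<^sup>2) = L * (\<Sum>k<L. (norm (a k))\<^sup>2)"
    by (simp only: of_real_eq_iff)
  moreover have "(\<lambda>k. (norm (a k))\<^sup>2) sums (\<Sum>k<L. (norm (a k))\<^sup>2)"
    by (rule sums_finite) (use f in \<open>auto simp: a_def hardy_poly_def not_less\<close>)
  then have "(\<Sum>k<L. (norm (a k))\<^sup>2) = (norm f)\<^sup>2"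
    using norm_hardy_sums[of f] unfolding a_def by (rule sums_unique2)
  ultimately show ?thesis by (simp add: v_def)
qed

section \<open>Operators with a coanalytic symbol\<close>

lemma hardy_poly_add: "hardy_poly M f \<Longrightarrow> hardy_poly N g \<Longrightarrow> hardy_poly (max M N) (f + g)"
  by (simp add: hardy_poly_def hardy_coeff_add)

lemma hardy_poly_scaleC: "hardy_poly N f \<Longrightarrow> hardy_poly N (c *\<^sub>C f)"
  by (simp add: hardy_poly_def hardy_coeff_scaleC scaleC_zero_right)

lemma boundary_value_add:
  assumes "hardy_poly M f" "hardy_poly N g"
  shows "boundary_value u (f + g) = boundary_value u f + boundary_value u g"
  unfolding boundary_value_eq[OF hardy_poly_add[OF assms]]
    boundary_value_eq[OF hardy_poly_mono[OF assms(1) max.cobounded1[of M N]]]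
    boundary_value_eq[OF hardy_poly_mono[OF assms(2) max.cobounded2[of N M]]]
  by (simp add: hardy_coeff_add scaleC_add_right sum.distrib)

lemma boundary_value_scaleC:
  assumes "hardy_poly N f"
  shows "boundary_value u (c *\<^sub>C f) = c *\<^sub>C boundary_value u f"
  unfolding boundary_value_eq[OF hardy_poly_scaleC[OF assms]] boundary_value_eq[OF assms]
  by (simp add: hardy_coeff_scaleC scaleC_sum_right scaleC_left_commute)

text \<open>An analytic Toeplitz operator multiplies boundary values by its symbol, without truncation.  Testing
  on polynomials is enough for norm bounds and avoids all questions of convergence.\<close>

definition has_symbol ::
    "('e::chilbert_space hardy \<Rightarrow> 'e hardy) \<Rightarrow> (complex \<Rightarrow> 'e \<Rightarrow> 'e) \<Rightarrow> bool" where
  "has_symbol S \<Phi> \<longleftrightarrow> (\<forall>f N. hardy_poly N f \<longrightarrow>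
     (\<exists>M. hardy_poly M (S f)) \<and>
     (\<forall>u. cmod u = 1 \<longrightarrow> boundary_value u (S f) = \<Phi> u (boundary_value u f)))"

lemma has_symbolE:
  assumes "has_symbol S \<Phi>" "hardy_poly N f"
  obtains M where "hardy_poly M (S f)"
    "\<And>u. cmod u = 1 \<Longrightarrow> boundary_value u (S f) = \<Phi> u (boundary_value u f)"
  using assms unfolding has_symbol_def by blast

lemma has_symbol_analytic_toeplitz:
  assumes A: "bounded_clinear A" and B: "bounded_clinear B"
  shows "has_symbol (analytic_toeplitz A B) (\<lambda>u x. A x + u *\<^sub>C B x)"
  unfolding has_symbol_def
proof (intro allI impI conjI)
  fix f :: "'a hardy" and N assume f: "hardy_poly N f"
  let ?a = "hardy_coeff f"
  have "delay ?a n = 0" if "n \<ge> Suc N" for n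
    using f that by (cases n) (simp_all add: hardy_poly_def)
  then have t: "hardy_poly (Suc N) (analytic_toeplitz A B f)"
    using f by (simp add: hardy_poly_def coeff_analytic_toeplitz[OF A B]
        bounded_clinear_zero[OF A] bounded_clinear_zero[OF B])
  then show "\<exists>M. hardy_poly M (analytic_toeplitz A B f)" by blast
  fix u :: complex
  have "boundary_value u (analytic_toeplitz A B f)
      = (\<Sum>n<Suc N. u ^ n *\<^sub>C A (?a n)) + (\<Sum>n<Suc N. u ^ n *\<^sub>C B (delay ?a n))"
    unfolding boundary_value_eq[OF t] coeff_analytic_toeplitz[OF A B] scaleC_add_right sum.distrib ..
  also have "(\<Sum>n<Suc N. u ^ n *\<^sub>C A (?a n)) = A (boundary_value u f)"
    unfolding boundary_value_eq[OF hardy_poly_mono[OF f le_SucI[OF order_refl]]]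
    by (simp only: bounded_clinear_sum[OF A] bounded_clinear_scaleC[OF A])
  also have "(\<Sum>n<Suc N. u ^ n *\<^sub>C B (delay ?a n)) = u *\<^sub>C B (boundary_value u f)"
    unfolding boundary_value_eq[OF f] sum.lessThan_Suc_shift
    by (simp add: bounded_clinear_simps[OF B] scaleC_sum_right scaleC_scaleC scaleC_zero_right)
  finally show "boundary_value u (analytic_toeplitz A B f)
      = A (boundary_value u f) + u *\<^sub>C B (boundary_value u f)" .
qed

text \<open>A coanalytic Toeplitz operator truncates, and so does not act on boundary values by multiplication;
  it is therefore described through its analytic adjoint.  Conjugating the argument of the symbol makes
  \<open>A + u B\<close> the cosymbol of \<open>coanalytic_toeplitz A B\<close>.  Being multiplicative, cosymbols extend to
  polynomials.\<close>

definition has_cosymbol ::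
    "('e::chilbert_space hardy \<Rightarrow> 'e hardy) \<Rightarrow> (complex \<Rightarrow> 'e \<Rightarrow> 'e) \<Rightarrow> bool" where
  "has_cosymbol T \<Psi> \<longleftrightarrow> (\<exists>S \<Phi>. adjoint_pair T S \<and> has_symbol S \<Phi> \<and>
     (\<forall>u. cmod u = 1 \<longrightarrow> adjoint_pair (\<Psi> (cnj u)) (\<Phi> u)))"

lemma has_cosymbol_coanalytic_toeplitz:
  assumes A: "bounded_clinear A" and B: "bounded_clinear B"
  shows "has_cosymbol (coanalytic_toeplitz A B) (\<lambda>u x. A x + u *\<^sub>C B x)"
proof -
  note aA = adjoint_pair_adj[OF A] and aB = adjoint_pair_adj[OF B]
  note A' = bounded_clinear_adjoint[OF A aA] and B' = bounded_clinear_adjoint[OF B aB]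
  have "adjoint_pair (\<lambda>x. A x + cnj u *\<^sub>C B x) (\<lambda>x. adj A x + u *\<^sub>C adj B x)" for u
    by (simp add: adjoint_pair_def cinner_simps adjoint_pairD[OF aA] adjoint_pairD[OF aB])
  then show ?thesis
    unfolding has_cosymbol_def
    using adjoint_pair_toeplitz[OF A A' aA B B' aB] has_symbol_analytic_toeplitz[OF A' B'] by blast
qed

lemma has_cosymbol_id: "has_cosymbol (\<lambda>f. f) (\<lambda>u x. x)"
  unfolding has_cosymbol_def has_symbol_def adjoint_pair_def
  by (intro exI[of _ "\<lambda>f. f"] exI[of _ "\<lambda>u x. x"]) blast

lemma has_cosymbol_compose:
  assumes "has_cosymbol T \<Psi>" "has_cosymbol T' \<Psi>'"
  shows "has_cosymbol (\<lambda>f. T (T' f)) (\<lambda>u x. \<Psi> u (\<Psi>' u x))"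
proof -
  obtain S \<Phi> S' \<Phi>' where 1: "adjoint_pair T S" "has_symbol S \<Phi>"
      "\<And>u. cmod u = 1 \<Longrightarrow> adjoint_pair (\<Psi> (cnj u)) (\<Phi> u)"
    and 2: "adjoint_pair T' S'" "has_symbol S' \<Phi>'"
      "\<And>u. cmod u = 1 \<Longrightarrow> adjoint_pair (\<Psi>' (cnj u)) (\<Phi>' u)"
    using assms unfolding has_cosymbol_def by blast
  have "has_symbol (\<lambda>f. S' (S f)) (\<lambda>u x. \<Phi>' u (\<Phi> u x))"
    unfolding has_symbol_def
    by (intro allI impI) (metis has_symbolE[OF 1(2)] has_symbolE[OF 2(2)])
  moreover have "adjoint_pair (\<lambda>f. T (T' f)) (\<lambda>f. S' (S f))"
    using 1(1) 2(1) by (simp add: adjoint_pair_def)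
  moreover have "adjoint_pair (\<lambda>x. \<Psi> (cnj u) (\<Psi>' (cnj u) x)) (\<lambda>x. \<Phi>' u (\<Phi> u x))" if "cmod u = 1" for u
    using 1(3)[OF that] 2(3)[OF that] by (simp add: adjoint_pair_def)
  ultimately show ?thesis unfolding has_cosymbol_def by blast
qed

lemma has_cosymbol_add:
  assumes "has_cosymbol T \<Psi>" "has_cosymbol T' \<Psi>'"
  shows "has_cosymbol (\<lambda>f. T f + T' f) (\<lambda>u x. \<Psi> u x + \<Psi>' u x)"
proof -
  obtain S \<Phi> S' \<Phi>' where 1: "adjoint_pair T S" "has_symbol S \<Phi>"
      "\<And>u. cmod u = 1 \<Longrightarrow> adjoint_pair (\<Psi> (cnj u)) (\<Phi> u)"
    and 2: "adjoint_pair T' S'" "has_symbol S' \<Phi>'"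
      "\<And>u. cmod u = 1 \<Longrightarrow> adjoint_pair (\<Psi>' (cnj u)) (\<Phi>' u)"
    using assms unfolding has_cosymbol_def by blast
  have "has_symbol (\<lambda>f. S f + S' f) (\<lambda>u x. \<Phi> u x + \<Phi>' u x)"
    unfolding has_symbol_def
  proof (intro allI impI)
    fix f :: "'a hardy" and N assume f: "hardy_poly N f"
    obtain M where M: "hardy_poly M (S f)"
        "\<And>u. cmod u = 1 \<Longrightarrow> boundary_value u (S f) = \<Phi> u (boundary_value u f)"
      by (rule has_symbolE[OF 1(2) f]) blast
    obtain M' where M': "hardy_poly M' (S' f)"
        "\<And>u. cmod u = 1 \<Longrightarrow> boundary_value u (S' f) = \<Phi>' u (boundary_value u f)"
      by (rule has_symbolE[OF 2(2) f]) blast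
    show "(\<exists>M. hardy_poly M (S f + S' f)) \<and> (\<forall>u. cmod u = 1 \<longrightarrow>
        boundary_value u (S f + S' f) = \<Phi> u (boundary_value u f) + \<Phi>' u (boundary_value u f))"
      using hardy_poly_add[OF M(1) M'(1)] by (auto simp: boundary_value_add[OF M(1) M'(1)] M(2) M'(2))
  qed
  moreover have "adjoint_pair (\<lambda>f. T f + T' f) (\<lambda>f. S f + S' f)"
    using 1(1) 2(1) by (simp add: adjoint_pair_def cinner_simps)
  moreover have "adjoint_pair (\<lambda>x. \<Psi> (cnj u) x + \<Psi>' (cnj u) x) (\<lambda>x. \<Phi> u x + \<Phi>' u x)"
    if "cmod u = 1" for u
    using 1(3)[OF that] 2(3)[OF that] by (simp add: adjoint_pair_def cinner_simps)
  ultimately show ?thesis unfolding has_cosymbol_def by blast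
qed

lemma has_cosymbol_scaled:
  assumes "has_cosymbol T \<Psi>"
  shows "has_cosymbol (\<lambda>f. c *\<^sub>C T f) (\<lambda>u x. c *\<^sub>C \<Psi> u x)"
proof -
  obtain S \<Phi> where 1: "adjoint_pair T S" "has_symbol S \<Phi>"
      "\<And>u. cmod u = 1 \<Longrightarrow> adjoint_pair (\<Psi> (cnj u)) (\<Phi> u)"
    using assms unfolding has_cosymbol_def by blast
  have "has_symbol (\<lambda>f. cnj c *\<^sub>C S f) (\<lambda>u x. cnj c *\<^sub>C \<Phi> u x)"
    unfolding has_symbol_def
  proof (intro allI impI)
    fix f :: "'a hardy" and N assume f: "hardy_poly N f"
    obtain M where M: "hardy_poly M (S f)"
        "\<And>u. cmod u = 1 \<Longrightarrow> boundary_value u (S f) = \<Phi> u (boundary_value u f)"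
      by (rule has_symbolE[OF 1(2) f]) blast
    show "(\<exists>M. hardy_poly M (cnj c *\<^sub>C S f)) \<and> (\<forall>u. cmod u = 1 \<longrightarrow>
        boundary_value u (cnj c *\<^sub>C S f) = cnj c *\<^sub>C \<Phi> u (boundary_value u f))"
      using hardy_poly_scaleC[OF M(1), of "cnj c"] by (auto simp: boundary_value_scaleC[OF M(1)] M(2))
  qed
  moreover have "adjoint_pair (\<lambda>f. c *\<^sub>C T f) (\<lambda>f. cnj c *\<^sub>C S f)"
    using 1(1) by (simp add: adjoint_pair_def cinner_simps)
  moreover have "adjoint_pair (\<lambda>x. c *\<^sub>C \<Psi> (cnj u) x) (\<lambda>x. cnj c *\<^sub>C \<Phi> u x)"
    if "cmod u = 1" for u
    using 1(3)[OF that] by (simp add: adjoint_pair_def cinner_simps)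
  ultimately show ?thesis unfolding has_cosymbol_def by blast
qed

lemma has_cosymbol_zero: "has_cosymbol (\<lambda>f. 0) (\<lambda>u x. 0)"
  using has_cosymbol_scaled[OF has_cosymbol_id, of 0] by (simp add: scaleC_zero_left)

lemma has_cosymbol_diff:
  assumes "has_cosymbol T \<Psi>" "has_cosymbol T' \<Psi>'"
  shows "has_cosymbol (\<lambda>f. T f - T' f) (\<lambda>u x. \<Psi> u x - \<Psi>' u x)"
  using has_cosymbol_add[OF assms(1) has_cosymbol_scaled[OF assms(2), of "-1"]]
  by (simp add: scaleC_minus_left scaleC_one)

lemma has_cosymbol_sum:
  "(\<And>i. i \<in> I \<Longrightarrow> has_cosymbol (T i) (\<Psi> i)) \<Longrightarrow>
    has_cosymbol (\<lambda>f. \<Sum>i\<in>I. T i f) (\<lambda>u x. \<Sum>i\<in>I. \<Psi> i u x)"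
  by (induction I rule: infinite_finite_induct) (simp_all add: has_cosymbol_zero has_cosymbol_add)

lemma has_cosymbol_funpow:
  assumes "has_cosymbol T \<Psi>"
  shows "has_cosymbol (T ^^ n) (\<lambda>u. \<Psi> u ^^ n)"
proof (induction n)
  case 0
  show ?case by (simp add: id_def has_cosymbol_id)
next
  case (Suc n)
  show ?case using has_cosymbol_compose[OF assms Suc] by (simp add: comp_def)
qed

lemma has_cosymbol_op_poly3:
  assumes "has_cosymbol T1 \<Psi>1" "has_cosymbol T2 \<Psi>2" "has_cosymbol T3 \<Psi>3"
  shows "has_cosymbol (op_poly3 p T1 T2 T3) (\<lambda>u. op_poly3 p (\<Psi>1 u) (\<Psi>2 u) (\<Psi>3 u))"
  unfolding op_poly3_def case_prod_unfold
  by (intro has_cosymbol_sum has_cosymbol_scaled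
      has_cosymbol_compose[OF has_cosymbol_funpow[OF assms(1)]
        has_cosymbol_compose[OF has_cosymbol_funpow[OF assms(2)] has_cosymbol_funpow[OF assms(3)]]])

text \<open>The pointwise bound is averaged over roots of unity of an order exceeding both degrees.\<close>

lemma norm_le_of_symbol_bound:
  assumes S: "has_symbol S \<Phi>" and f: "hardy_poly N f" and "C \<ge> 0"
    and bound: "\<And>u x. cmod u = 1 \<Longrightarrow> norm (\<Phi> u x) \<le> C * norm x"
  shows "norm (S f) \<le> C * norm f"
proof -
  obtain M where M: "hardy_poly M (S f)"
      "\<And>u. cmod u = 1 \<Longrightarrow> boundary_value u (S f) = \<Phi> u (boundary_value u f)"
    by (rule has_symbolE[OF S f]) blast
  define L where "L = Suc (max M N)"
  define v where "v j = cis (2 * pi / L) ^ j" for j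
  have v: "cmod (v j) = 1" for j by (simp add: v_def norm_power)
  have t: "hardy_poly L f" "hardy_poly L (S f)"
    using f M(1) by (auto simp: L_def intro: hardy_poly_mono)
  have "L * (norm (S f))\<^sup>2 = (\<Sum>j<L. (norm (\<Phi> (v j) (boundary_value (v j) f)))\<^sup>2)"
    unfolding parseval_roots_of_unity[OF t(2), symmetric] by (simp add: M(2)[OF v] v_def[symmetric])
  also have "\<dots> \<le> (\<Sum>j<L. C\<^sup>2 * (norm (boundary_value (v j) f))\<^sup>2)"
    unfolding power_mult_distrib[symmetric] by (intro sum_mono power_mono bound v) simp
  also have "\<dots> = L * (C * norm f)\<^sup>2"
    unfolding sum_distrib_left[symmetric] v_def parseval_roots_of_unity[OF t(1)]
    by (simp add: power_mult_distrib)
  finally have "(norm (S f))\<^sup>2 \<le> (C * norm f)\<^sup>2" by (simp add: L_def)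
  then show ?thesis by (rule power2_le_imp_le) (simp add: \<open>C \<ge> 0\<close>)
qed

text \<open>By duality from \<open>norm_le_of_symbol_bound\<close>: pairing \<open>T f\<close> with its own Taylor polynomial \<open>g\<close>
  puts the adjoint on the polynomial \<open>g\<close>, and bounds \<open>|g|\<close> by \<open>C |f|\<close>.\<close>

lemma norm_le_of_cosymbol_bound:
  assumes T: "has_cosymbol T \<Psi>" and C: "C \<ge> 0"
    and bound: "\<And>u x. cmod u = 1 \<Longrightarrow> norm (\<Psi> u x) \<le> C * norm x"
  shows "norm (T f) \<le> C * norm f"
proof (rule norm_hardy_le)
  obtain S \<Phi> where 1: "adjoint_pair T S" "has_symbol S \<Phi>"
      "\<And>u. cmod u = 1 \<Longrightarrow> adjoint_pair (\<Psi> (cnj u)) (\<Phi> u)"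
    using T unfolding has_cosymbol_def by blast
  have \<Phi>: "norm (\<Phi> u x) \<le> C * norm x" if "cmod u = 1" for u x
    using adjoint_pair_norm_le[OF 1(3)[OF that] bound C] that by simp
  fix N
  define g where "g = hardy_of (\<lambda>n. if n < N then hardy_coeff (T f) n else 0)"
  have "square_summable (\<lambda>n. if n < N then hardy_coeff (T f) n else 0)"
    unfolding square_summable_def by (rule summable_finite[of "{..<N}"]) auto
  then have g: "hardy_coeff g n = (if n < N then hardy_coeff (T f) n else 0)" for n
    by (simp add: g_def hardy_coeff_of)
  have tg: "hardy_poly N g" by (simp add: hardy_poly_def g)
  have "(\<lambda>n. (norm (hardy_coeff g n))\<^sup>2) sums (\<Sum>n<N. (norm (hardy_coeff g n))\<^sup>2)"
    by (rule sums_finite) (auto simp: g)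
  then have ng: "(norm g)\<^sup>2 = (\<Sum>n<N. (norm (hardy_coeff (T f) n))\<^sup>2)"
    using norm_hardy_sums[of g] sums_unique2 by (fastforce simp: g)
  have "(\<lambda>n. cinner (hardy_coeff g n) (hardy_coeff g n)) sums cinner (T f) g"
    using cinner_hardy_sums[of "T f" g] by (rule back_subst[of "\<lambda>s. s sums _"])
      (auto simp: g cinner_zero_right fun_eq_iff)
  then have "cinner (T f) g = cinner g g" using cinner_hardy_sums[of g g] sums_unique2 by blast
  then have "(norm g)\<^sup>2 = cmod (cinner f (S g))"
    using adjoint_pairD[OF 1(1), of f g] by (simp add: cinner_self norm_power)
  also have "\<dots> \<le> norm f * (C * norm g)"
    by (rule order_trans[OF norm_cinner_le])
       (intro mult_left_mono norm_le_of_symbol_bound[OF 1(2) tg C \<Phi>] norm_ge_zero)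
  finally have "norm g * norm g \<le> (C * norm f) * norm g" by (simp add: power2_eq_square mult_ac)
  then have "norm g \<le> C * norm f"
    by (cases "norm g = 0") (use C in \<open>auto simp: mult_le_cancel_right\<close>)
  then have "(norm g)\<^sup>2 \<le> (C * norm f)\<^sup>2" by (rule power_mono) simp
  then show "(\<Sum>n<N. (norm (hardy_coeff (T f) n))\<^sup>2) \<le> (C * norm f)\<^sup>2" by (simp only: ng)
qed (simp add: C)

section \<open>Koszul exactness and invertibility\<close>

text \<open>With \<open>Q\<close> the given combination, the operators \<open>Bi = ci Q\<^sup>-\<^sup>1\<close> commute with the \<open>Uj\<close> and
  satisfy \<open>U1 B1 + U2 B2 + U3 B3 = 1\<close>.  Contraction with \<open>(B1, B2, B3)\<close> is then a homotopy from the identity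
  of the Koszul complex to zero; it supplies the preimages used at each of the four places.\<close>

lemma koszul_exact_of_bij_combination:
  fixes U1 U2 U3 :: "'h::chilbert_space \<Rightarrow> 'h"
  assumes U: "bounded_clinear U1" "bounded_clinear U2" "bounded_clinear U3"
    and comm: "\<And>x. U1 (U2 x) = U2 (U1 x)" "\<And>x. U1 (U3 x) = U3 (U1 x)" "\<And>x. U2 (U3 x) = U3 (U2 x)"
    and bij: "bij (\<lambda>x. c1 *\<^sub>C U1 x + c2 *\<^sub>C U2 x + c3 *\<^sub>C U3 x)"
  shows "koszul_exact U1 U2 U3"
proof -
  note lin = bounded_clinear_simps[OF U(1)] bounded_clinear_simps[OF U(2)] bounded_clinear_simps[OF U(3)]
  define Q where "Q x = c1 *\<^sub>C U1 x + c2 *\<^sub>C U2 x + c3 *\<^sub>C U3 x" for x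
  define R where "R = inv Q"
  have Q: "bij Q" using bij by (simp add: Q_def[abs_def])
  have QR: "Q (R x) = x" for x using Q by (simp add: R_def bij_is_surj surj_f_inv_f)
  have R_eq: "R x = y \<longleftrightarrow> x = Q y" for x y by (metis Q QR R_def bij_is_inj inv_f_f)
  have UR: "R (U1 x) = U1 (R x)" "R (U2 x) = U2 (R x)" "R (U3 x) = U3 (R x)" for x
  proof -
    have "U1 (Q y) = Q (U1 y)" "U2 (Q y) = Q (U2 y)" "U3 (Q y) = Q (U3 y)" for y
      by (simp_all add: Q_def lin comm)
    then show "R (U1 x) = U1 (R x)" "R (U2 x) = U2 (R x)" "R (U3 x) = U3 (R x)"
      by (metis R_eq)+
  qed
  have Qlin: "Q (x + y) = Q x + Q y" "Q (c *\<^sub>C x) = c *\<^sub>C Q x" "Q 0 = 0" for x y c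
    by (simp_all add: Q_def lin scaleC_simps mult.commute)
  have Rlin: "R (x + y) = R x + R y" "R (c *\<^sub>C x) = c *\<^sub>C R x" "R 0 = 0" for x y c
    by (simp_all add: R_eq Qlin QR)
  define B1 B2 B3 where "B1 x = c1 *\<^sub>C R x" and "B2 x = c2 *\<^sub>C R x" and "B3 x = c3 *\<^sub>C R x" for x
  have Badd: "B1 (x + y) = B1 x + B1 y" "B2 (x + y) = B2 x + B2 y" "B3 (x + y) = B3 x + B3 y" for x y
    by (simp_all add: B1_def B2_def B3_def Rlin scaleC_add_right)
  have B0: "B1 0 = 0" "B2 0 = 0" "B3 0 = 0"
    by (simp_all add: B1_def B2_def B3_def Rlin scaleC_zero_right)
  have BU: "B1 (U1 x) = U1 (B1 x)" "B1 (U2 x) = U2 (B1 x)" "B1 (U3 x) = U3 (B1 x)"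
    "B2 (U1 x) = U1 (B2 x)" "B2 (U2 x) = U2 (B2 x)" "B2 (U3 x) = U3 (B2 x)"
    "B3 (U1 x) = U1 (B3 x)" "B3 (U2 x) = U2 (B3 x)" "B3 (U3 x) = U3 (B3 x)" for x
    by (simp_all add: B1_def B2_def B3_def UR lin)
  have one: "U1 (B1 x) + U2 (B2 x) + U3 (B3 x) = x" for x
    using QR[of x] by (simp add: Q_def B1_def B2_def B3_def lin)
  have "{x. koszul0 U1 U2 U3 x = 0} = {0}"
  proof -
    have "x = 0" if "U1 x = 0" "U2 x = 0" "U3 x = 0" for x
      using one[of x] by (simp add: BU[symmetric] that B0)
    then show ?thesis by (auto simp: koszul0_def zero_prod_def lin)
  qed
  moreover have "{u. koszul1 U1 U2 U3 u = 0} = range (koszul0 U1 U2 U3)"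
  proof (intro equalityI subsetI)
    fix u assume "u \<in> {u. koszul1 U1 U2 U3 u = 0}"
    then obtain x y z where u: "u = (x, y, z)" and e: "U1 y = U2 x" "U1 z = U3 x" "U2 z = U3 y"
      by (cases u) (auto simp: koszul1_def zero_prod_def)
    have "U1 (B1 x + B2 y + B3 z) = U1 (B1 x) + U2 (B2 x) + U3 (B3 x)"
      "U2 (B1 x + B2 y + B3 z) = U1 (B1 y) + U2 (B2 y) + U3 (B3 y)"
      "U3 (B1 x + B2 y + B3 z) = U1 (B1 z) + U2 (B2 z) + U3 (B3 z)"
      by (simp_all add: lin BU[symmetric] e)
    then have "koszul0 U1 U2 U3 (B1 x + B2 y + B3 z) = u" unfolding koszul0_def u one by simp
    then show "u \<in> range (koszul0 U1 U2 U3)" by blast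
  qed (auto simp: koszul0_def koszul1_def zero_prod_def comm)
  moreover have "{u. koszul2 U1 U2 U3 u = 0} = range (koszul1 U1 U2 U3)"
  proof (intro equalityI subsetI)
    fix u assume "u \<in> {u. koszul2 U1 U2 U3 u = 0}"
    then obtain x y z where u: "u = (x, y, z)" and e: "U1 z - U2 y + U3 x = 0"
      by (cases u) (auto simp: koszul2_def)
    have e': "U1 z + U3 x = U2 y" using e by (simp add: algebra_simps)
    have "U1 (B z) + U3 (B x) = U2 (B y)"
      if "\<And>x y. B (x + y) = B x + B y" "\<And>x. B (U1 x) = U1 (B x)" "\<And>x. B (U2 x) = U2 (B x)"
        "\<And>x. B (U3 x) = U3 (B x)" for B
      using arg_cong[OF e', of B] by (simp add: that)
    note eB = this[of B1, OF Badd(1) BU(1-3)] this[of B2, OF Badd(2) BU(4-6)]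
      this[of B3, OF Badd(3) BU(7-9)]
    define a b c where "a = - (B2 x + B3 y)" and "b = B1 x - B3 z" and "c = B1 y + B2 z"
    have "U1 b - U2 a = U1 (B1 x) + U2 (B2 x) + (U2 (B3 y) - U1 (B3 z))"
      "U1 c - U3 a = U1 (B1 y) + (U1 (B2 z) + U3 (B2 x)) + U3 (B3 y)"
      "U2 c - U3 b = (U2 (B1 y) - U3 (B1 x)) + U2 (B2 z) + U3 (B3 z)"
      unfolding a_def b_def c_def
      using bounded_clinear_diff[OF U(2), of 0] bounded_clinear_diff[OF U(3), of 0]
      by (simp_all add: lin)
    moreover have "U2 (B3 y) - U1 (B3 z) = U3 (B3 x)" "U1 (B2 z) + U3 (B2 x) = U2 (B2 y)"
      "U2 (B1 y) - U3 (B1 x) = U1 (B1 z)"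
      using eB by (simp_all add: algebra_simps)
    ultimately have "U1 b - U2 a = x" "U1 c - U3 a = y" "U2 c - U3 b = z"
      by (simp_all only: one)
    then have "koszul1 U1 U2 U3 (a, b, c) = u" by (simp add: koszul1_def u)
    then show "u \<in> range (koszul1 U1 U2 U3)" by blast
  qed (auto simp: koszul1_def koszul2_def lin comm)
  moreover have "range (koszul2 U1 U2 U3) = UNIV"
  proof -
    have "koszul2 U1 U2 U3 (B3 y, - B2 y, B1 y) = y" for y
      using one[of y] bounded_clinear_diff[OF U(2), of 0 "B2 y"]
      by (simp add: koszul2_def lin algebra_simps)
    then show ?thesis by (rule surjI)
  qed
  ultimately show ?thesis unfolding koszul_exact_def by blast
qed

lemma bij_identity_minus_contraction:
  fixes X :: "'h::{real_normed_vector,complete_space} \<Rightarrow> 'h"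
  assumes diff: "\<And>x y. X (x - y) = X x - X y" and bound: "\<And>x. norm (X x) \<le> c * norm x"
    and c: "0 \<le> c" "c < 1"
  shows "bij (\<lambda>x. x - X x)"
  unfolding bij_iff
proof
  fix y
  have "\<exists>!x. y + X x = x"
    by (rule banach_fix_type[OF c]) (simp add: dist_norm diff[symmetric] bound)
  moreover have "y + X x = x \<longleftrightarrow> x - X x = y" for x by (auto simp: algebra_simps)
  ultimately show "\<exists>!x. x - X x = y" by simp
qed

lemma sum_funpow_telescope:
  fixes X :: "'h::complex_inner \<Rightarrow> 'h"
  assumes X: "bounded_clinear X"
  shows "(\<Sum>k<m. (X ^^ k) x) - X (\<Sum>k<m. (X ^^ k) x) = x - (X ^^ m) x"
    and "(\<Sum>k<m. (X ^^ k) (x - X x)) = x - (X ^^ m) x"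
proof -
  show "(\<Sum>k<m. (X ^^ k) x) - X (\<Sum>k<m. (X ^^ k) x) = x - (X ^^ m) x"
  proof (induction m)
    case (Suc m)
    let ?s = "\<Sum>k<m. (X ^^ k) x"
    have "(?s + (X ^^ m) x) - X (?s + (X ^^ m) x) = (?s - X ?s) + ((X ^^ m) x - X ((X ^^ m) x))"
      by (simp add: bounded_clinear_add[OF X])
    also have "\<dots> = x - (X ^^ Suc m) x" unfolding Suc by simp
    finally show ?case by simp
  qed (simp add: bounded_clinear_zero[OF X])
  show "(\<Sum>k<m. (X ^^ k) (x - X x)) = x - (X ^^ m) x"
    by (induction m)
       (simp_all add: bounded_clinear_diff[OF bounded_clinear_funpow[OF X]] funpow_swap1)
qed

lemma norm_funpow_le:
  fixes X :: "'h::real_normed_vector \<Rightarrow> 'h"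
  assumes "\<And>x. norm (X x) \<le> c * norm x" "0 \<le> c"
  shows "norm ((X ^^ m) x) \<le> c ^ m * norm x"
proof (induction m)
  case (Suc m)
  have "norm (X ((X ^^ m) x)) \<le> c * norm ((X ^^ m) x)" by (rule assms(1))
  also have "\<dots> \<le> c * (c ^ m * norm x)" using Suc assms(2) by (rule mult_left_mono)
  finally show ?case by (simp add: mult.assoc)
qed simp

section \<open>Square roots of projections\<close>

text \<open>On the range of \<open>P\<close> a positive square root \<open>D\<close> squares to the identity, and \<open>v = D x - x\<close>
  satisfies \<open>D v = - v\<close>, which positivity forbids unless \<open>v = 0\<close>; on the kernel of \<open>P\<close>, \<open>D\<close> squares
  to zero and positivity forces \<open>D = 0\<close>.\<close>

lemma pos_sqrt_projection:
  assumes P: "bounded_clinear P" and sa: "adjoint_pair P P" and idem: "\<And>x. P (P x) = P x"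
  shows "pos_sqrt P = P"
  unfolding pos_sqrt_def
proof (rule the_equality)
  have "cinner (P x) x = of_real ((norm (P x))\<^sup>2)" for x
    using adjoint_pairD[OF sa, of "P x" x] by (simp add: idem cinner_self)
  then show "positive_op P \<and> P \<circ> P = P"
    using P idem by (auto simp: positive_op_def fun_eq_iff)
next
  fix D assume D: "positive_op D \<and> D \<circ> D = P"
  then have Db: "bounded_clinear D" and pos: "\<And>x. 0 \<le> Re (cinner (D x) x)"
    and DD: "\<And>x. D (D x) = P x"
    by (auto simp: positive_op_def fun_eq_iff)
  note lin = bounded_clinear_simps[OF Db]
  have range: "D (P x) = P x" for x
  proof -
    define v where "v = D (P x) - P x"
    have "D v = - v" using DD[of "P x"] by (simp add: v_def lin idem)
    then have "0 \<le> - (norm v)\<^sup>2" using pos[of v] cinner_diff_left[of 0 v v]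
      by (simp add: cinner_zero_left cinner_self)
    then show ?thesis by (simp add: v_def)
  qed
  have kernel: "D y = 0" if "P y = 0" for y
  proof -
    \<comment> \<open>\<open>D y\<close> is killed by \<open>D\<close>, so the form is affine along \<open>y + s D y\<close> and would change sign\<close>
    have "D (D y) = 0" using DD that by simp
    then have lin_form: "0 \<le> inner (D y) y + s * (norm (D y))\<^sup>2" for s :: real
      using pos[of "y + s *\<^sub>R D y"]
      by (simp add: lin scaleR_scaleC scaleC_zero_right inner_eq_Re_cinner[symmetric] inner_add_right)
        (simp add: scaleR_scaleC[symmetric] power2_norm_eq_inner)
    show ?thesis
    proof (rule ccontr)
      assume "D y \<noteq> 0"
      then show False
        using lin_form[of "- (\<bar>inner (D y) y\<bar> + 1) / (norm (D y))\<^sup>2"] by simp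
    qed
  qed
  show "D = P"
  proof
    fix x
    have "D (x - P x) = 0" using bounded_clinear_diff[OF P] by (intro kernel) (simp add: idem)
    then show "D x = P x" by (simp add: lin range)
  qed
qed

section \<open>The constant functions\<close>

definition hardy_const :: "'e::chilbert_space \<Rightarrow> 'e hardy" where
  "hardy_const x = hardy_of (\<lambda>n. if n = 0 then x else 0)"

lemma coeff_hardy_const: "hardy_coeff (hardy_const x) n = (if n = 0 then x else 0)"
proof -
  have "square_summable (\<lambda>n. if n = (0::nat) then x else 0)"
    unfolding square_summable_def by (rule summable_finite[of "{0}"]) auto
  then show ?thesis by (simp add: hardy_const_def hardy_coeff_of)
qed

lemma hardy_const_add: "hardy_const (x + y) = hardy_const x + hardy_const y"
  and hardy_const_scaleC: "hardy_const (c *\<^sub>C x) = c *\<^sub>C hardy_const x"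
  by (rule hardy_eqI, simp add: coeff_hardy_const hardy_coeff_simps scaleC_zero_right)+

lemma cinner_hardy_const: "cinner (hardy_const x) f = cinner x (hardy_coeff f 0)"
proof -
  have "(\<lambda>n. cinner (hardy_coeff (hardy_const x) n) (hardy_coeff f n)) sums
      (\<Sum>n\<in>{0}. cinner (hardy_coeff (hardy_const x) n) (hardy_coeff f n))"
    by (rule sums_finite) (auto simp: coeff_hardy_const cinner_zero_left)
  then have "cinner (hardy_const x) f
      = (\<Sum>n\<in>{0}. cinner (hardy_coeff (hardy_const x) n) (hardy_coeff f n))"
    by (rule sums_unique2[OF cinner_hardy_sums])
  then show ?thesis by (simp add: coeff_hardy_const)
qed

lemma norm_hardy_const: "norm (hardy_const x) = norm x"
proof -
  have "complex_of_real ((norm (hardy_const x))\<^sup>2) = complex_of_real ((norm x)\<^sup>2)"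
    unfolding cinner_self[symmetric] cinner_hardy_const by (simp add: coeff_hardy_const)
  then have "(norm (hardy_const x))\<^sup>2 = (norm x)\<^sup>2" by (simp only: of_real_eq_iff)
  then show ?thesis by simp
qed

definition const_proj :: "'e::chilbert_space hardy \<Rightarrow> 'e hardy" where
  "const_proj f = hardy_const (hardy_coeff f 0)"

lemma const_proj_const: "const_proj (hardy_const x) = hardy_const x"
  by (simp add: const_proj_def coeff_hardy_const)

lemma bounded_clinear_const_proj: "bounded_clinear const_proj"
  by (rule bounded_clinearI[where K = 1])
     (simp_all add: const_proj_def hardy_coeff_simps hardy_const_add hardy_const_scaleC
        norm_hardy_const norm_hardy_coeff_le)

lemma adjoint_pair_const_proj: "adjoint_pair const_proj const_proj"
  unfolding adjoint_pair_def const_proj_def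
  by (metis cinner_commute cinner_hardy_const coeff_hardy_const)

lemma closure_range_const_proj: "closure (range const_proj) = range hardy_const"
proof -
  have "range const_proj = range hardy_const"
    by (metis (no_types, lifting) const_proj_const const_proj_def image_cong image_image
        subset_antisym image_subsetI rangeI)
  moreover have "range const_proj = {f. const_proj f = f}"
  proof (intro equalityI subsetI)
    fix f assume "f \<in> {f. const_proj f = f}"
    then have "f = const_proj f" by simp
    then show "f \<in> range const_proj" by (rule range_eqI)
  qed (auto simp: const_proj_def coeff_hardy_const)
  moreover have "closed {f. const_proj f = f}"
    by (intro closed_Collect_eq linear_continuous_on continuous_on_id
        bounded_clinear_bounded_linear[OF bounded_clinear_const_proj])
  ultimately show ?thesis by (metis closure_closed)
qed

section \<open>The tetrablock contraction of a commuting pencil\<close>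

lemma bounded_clinear_coanalytic_toeplitz:
  assumes A: "bounded_clinear A" and B: "bounded_clinear B"
  shows "bounded_clinear (coanalytic_toeplitz A B)"
proof -
  obtain K where K: "K > 0" "\<And>x. norm (A x) \<le> K * norm x"
    using A by (rule bounded_clinear_boundedE) blast
  obtain M where M: "M > 0" "\<And>x. norm (B x) \<le> M * norm x"
    using B by (rule bounded_clinear_boundedE) blast
  have "norm (A x + u *\<^sub>C B x) \<le> (K + M) * norm x" if "cmod u = 1" for u x
    using norm_triangle_ineq[of "A x" "u *\<^sub>C B x"] K(2)[of x] M(2)[of x] that
    by (simp add: norm_scaleC distrib_right)
  then have "norm (coanalytic_toeplitz A B f) \<le> (K + M) * norm f" for f
    using K(1) M(1)
    by (intro norm_le_of_cosymbol_bound[OF has_cosymbol_coanalytic_toeplitz[OF A B]]) auto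
  then show ?thesis
    by (intro bounded_clinearI hardy_eqI)
       (simp_all add: coeff_coanalytic_toeplitz[OF A B] hardy_coeff_simps
         bounded_clinear_simps[OF A] bounded_clinear_simps[OF B] scaleC_add_right)
qed

abbreviation backward_shift :: "'e::chilbert_space hardy \<Rightarrow> 'e hardy" where
  "backward_shift \<equiv> coanalytic_toeplitz (\<lambda>x. 0) (\<lambda>x. x)"

lemmas coeff_backward_shift = coeff_coanalytic_toeplitz[OF bounded_clinear_zero_op bounded_clinear_id]

lemma adj_backward_shift: "adj backward_shift = analytic_toeplitz (\<lambda>x. 0) (\<lambda>x. x)"
  by (intro adj_eqI adjoint_pair_toeplitz bounded_clinear_id bounded_clinear_zero_op)
     (simp_all add: adjoint_pair_def cinner_zero_left cinner_zero_right)

lemma defect_op_backward_shift: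
  "defect_op backward_shift = (const_proj :: 'e::chilbert_space hardy \<Rightarrow> 'e hardy)"
proof -
  have "f - adj backward_shift (backward_shift f) = const_proj f" for f :: "'e hardy"
  proof (rule hardy_eqI)
    fix n show "hardy_coeff (f - adj backward_shift (backward_shift f)) n = hardy_coeff (const_proj f) n"
      by (cases n) (simp_all add: adj_backward_shift hardy_coeff_diff const_proj_def coeff_hardy_const coeff_backward_shift
          coeff_analytic_toeplitz[OF bounded_clinear_zero_op bounded_clinear_id])
  qed
  then have "defect_op backward_shift = pos_sqrt (const_proj :: 'e hardy \<Rightarrow> 'e hardy)"
    by (simp add: defect_op_def)
  also have "\<dots> = const_proj"
    by (rule pos_sqrt_projection[OF bounded_clinear_const_proj adjoint_pair_const_proj])
       (simp add: const_proj_def coeff_hardy_const)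
  finally show ?thesis .
qed

lemma defect_space_backward_shift: "defect_space backward_shift = range hardy_const"
  by (simp add: defect_space_def defect_op_backward_shift closure_range_const_proj)

lemma bounded_op_on_constants:
  assumes A: "bounded_clinear A"
  shows "bounded_op_on (range hardy_const) (\<lambda>f. hardy_const (A (hardy_coeff f 0)))"
proof -
  obtain K where "K > 0" "\<And>x. norm (A x) \<le> K * norm x"
    using A by (rule bounded_clinear_boundedE) blast
  then have "\<exists>K. \<forall>f\<in>range hardy_const. norm (hardy_const (A (hardy_coeff f 0))) \<le> K * norm f"
    by (auto simp: norm_hardy_const coeff_hardy_const)
  then show ?thesis
    unfolding bounded_op_on_def clinear_on_def
    by (auto simp: hardy_coeff_simps bounded_clinear_simps[OF A] hardy_const_add hardy_const_scaleC)
qed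

lemma unitary_from_constants: "unitary_from (range hardy_const) (\<lambda>f. hardy_coeff f 0)"
  unfolding unitary_from_def clinear_on_def
  by (auto simp: hardy_coeff_simps cinner_hardy_const coeff_hardy_const image_image)

context
  fixes A1 A2 :: "'e::chilbert_space \<Rightarrow> 'e"
  assumes A1: "bounded_clinear A1" and A2: "bounded_clinear A2"
    and comm: "A1 \<circ> A2 = A2 \<circ> A1"
    and self_comm: "commutator (adj A1) A1 = commutator (adj A2) A2"
    and rad: "\<And>z. cmod z = 1 \<Longrightarrow> numerical_radius (\<lambda>x. A1 x + z *\<^sub>C A2 x) \<le> 1"
begin

text \<open>The adjoints of multiplication by \<open>A1\<^sup>* + z A2\<close>, \<open>A2\<^sup>* + z A1\<close> and \<open>z\<close>.\<close>

abbreviation "Tet1 \<equiv> coanalytic_toeplitz A1 (adj A2)"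
abbreviation "Tet2 \<equiv> coanalytic_toeplitz A2 (adj A1)"
abbreviation "Tet3 \<equiv> (backward_shift :: 'e hardy \<Rightarrow> 'e hardy)"

lemma adjoint_pair_A1: "adjoint_pair A1 (adj A1)" and adjoint_pair_A2: "adjoint_pair A2 (adj A2)"
  by (intro adjoint_pair_adj A1 A2)+

lemma bounded_adj_A1: "bounded_clinear (adj A1)" and bounded_adj_A2: "bounded_clinear (adj A2)"
  by (rule bounded_clinear_adjoint[OF A1 adjoint_pair_A1] bounded_clinear_adjoint[OF A2 adjoint_pair_A2])+

lemma bounded_Tet1: "bounded_clinear Tet1" and bounded_Tet2: "bounded_clinear Tet2" and bounded_Tet3: "bounded_clinear Tet3"
  by (intro bounded_clinear_coanalytic_toeplitz A1 A2 bounded_adj_A1 bounded_adj_A2 bounded_clinear_id bounded_clinear_zero_op)+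

lemmas coeff_Tet1 = coeff_coanalytic_toeplitz[OF A1 bounded_adj_A2]
lemmas coeff_Tet2 = coeff_coanalytic_toeplitz[OF A2 bounded_adj_A1]

lemma A_commute: "A1 (A2 x) = A2 (A1 x)"
  using comm by (simp add: fun_eq_iff)

lemma A_adj_commute: "adj A1 (adj A2 x) = adj A2 (adj A1 x)"
  by (rule cinner_ext)
     (simp add: adjoint_pairD[OF adjoint_pair_sym[OF adjoint_pair_A1]] adjoint_pairD[OF adjoint_pair_sym[OF adjoint_pair_A2]]
       A_commute)

lemma self_commutators: "adj A1 (A1 x) + A2 (adj A2 x) = adj A2 (A2 x) + A1 (adj A1 x)"
  using fun_cong[OF self_comm, of x] by (simp add: commutator_def algebra_simps)

text \<open>The commutation of \<open>A1\<close> and \<open>A2\<close> settles the coefficients at \<open>f\<^sub>n\<close> and \<open>f\<^sub>n\<^sub>+\<^sub>2\<close>, and the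
  equality of the self-commutators the one at \<open>f\<^sub>n\<^sub>+\<^sub>1\<close>.\<close>

lemma Tet12_commute: "Tet1 \<circ> Tet2 = Tet2 \<circ> Tet1"
proof (rule ext, rule hardy_eqI)
  fix f n
  show "hardy_coeff ((Tet1 \<circ> Tet2) f) n = hardy_coeff ((Tet2 \<circ> Tet1) f) n"
    using self_commutators[of "hardy_coeff f (Suc n)"]
    by (simp add: coeff_Tet1 coeff_Tet2 bounded_clinear_add[OF A1] bounded_clinear_add[OF A2]
        bounded_clinear_add[OF bounded_adj_A1] bounded_clinear_add[OF bounded_adj_A2] A_commute A_adj_commute algebra_simps)
qed

lemma Tet13_commute: "Tet1 \<circ> Tet3 = Tet3 \<circ> Tet1" and Tet23_commute: "Tet2 \<circ> Tet3 = Tet3 \<circ> Tet2"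
  by (rule ext, rule hardy_eqI, simp add: coeff_Tet1 coeff_Tet2 coeff_backward_shift)+

text \<open>The symbol of \<open>Tet2\<close> and its pointwise adjoint.  For \<open>|u| = 1\<close> the symbol of \<open>Tet1\<close> is
  \<open>u copencil u\<close>.\<close>

definition pencil :: "complex \<Rightarrow> 'e \<Rightarrow> 'e" where "pencil u x = A2 x + u *\<^sub>C adj A1 x"
definition copencil :: "complex \<Rightarrow> 'e \<Rightarrow> 'e" where "copencil u x = adj A2 x + cnj u *\<^sub>C A1 x"

lemma bounded_pencil: "bounded_clinear (pencil u)"
  unfolding pencil_def[abs_def] by (intro bounded_clinear_plus bounded_clinear_scaled A2 bounded_adj_A1)

lemma adjoint_pair_pencil: "adjoint_pair (pencil u) (copencil u)"
  by (simp add: adjoint_pair_def pencil_def copencil_def cinner_simps adjoint_pairD[OF adjoint_pair_A2]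
      adjoint_pairD[OF adjoint_pair_sym[OF adjoint_pair_A1]])

lemma pencil_normal:
  assumes u: "cmod u = 1"
  shows "pencil u (copencil u x) = copencil u (pencil u x)"
proof -
  have "u * cnj u = 1" using u by (simp add: complex_norm_square[symmetric])
  then show ?thesis
    using self_commutators[of x]
    by (simp add: pencil_def copencil_def bounded_clinear_simps[OF A1] bounded_clinear_simps[OF A2]
        bounded_clinear_simps[OF bounded_adj_A1] bounded_clinear_simps[OF bounded_adj_A2] scaleC_simps A_commute
        A_adj_commute algebra_simps)
qed

lemma pencil_form:
  assumes u: "cmod u = 1" and x: "norm x = 1"
  shows "cmod (cinner (pencil u x) x) \<le> 1"
proof -
  have "cmod (cinner (pencil u x) x) \<le> cmod (cinner (A2 x) x) + cmod (cinner (adj A1 x) x)"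
    using norm_triangle_ineq[of "cinner (A2 x) x" "u * cinner (adj A1 x) x"] u
    by (simp add: pencil_def cinner_simps norm_mult)
  also have "cmod (cinner (adj A1 x) x) = cmod (cinner (A1 x) x)"
    unfolding adjoint_pairD[OF adjoint_pair_sym[OF adjoint_pair_A1]]
    by (subst cinner_commute) simp
  finally show ?thesis using pencil_quadratic_forms_le[OF A1 A2 rad x] by simp
qed

lemma norm_pencil_le:
  assumes u: "cmod u = 1"
  shows "norm (pencil u x) \<le> norm x"
  by (rule norm_normal_le[of "pencil u" "copencil u", OF bounded_pencil adjoint_pair_pencil pencil_normal[OF u] pencil_form[OF u]])

lemma norm_copencil_le:
  assumes u: "cmod u = 1"
  shows "norm (copencil u x) \<le> norm x"
  using norm_pencil_le[OF u, of x] adjoint_pair_normal_norm[of "pencil u" "copencil u" x, OF adjoint_pair_pencil pencil_normal[OF u]] by simp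

lemma cosymbol_Tet1: "has_cosymbol Tet1 (\<lambda>u x. A1 x + u *\<^sub>C adj A2 x)"
  and cosymbol_Tet2: "has_cosymbol Tet2 pencil"
  and cosymbol_Tet3: "has_cosymbol Tet3 (\<lambda>u x. u *\<^sub>C x)"
  using has_cosymbol_coanalytic_toeplitz[OF A1 bounded_adj_A2] has_cosymbol_coanalytic_toeplitz[OF A2 bounded_adj_A1]
    has_cosymbol_coanalytic_toeplitz[OF bounded_clinear_zero_op bounded_clinear_id]
  by (simp_all add: pencil_def[abs_def])

lemma symbol_Tet1: "cmod u = 1 \<Longrightarrow> A1 x + u *\<^sub>C adj A2 x = u *\<^sub>C copencil u x"
  using complex_norm_square[of u] by (simp add: copencil_def scaleC_simps)

lemma Sup_cmod_eval_poly3_nonneg: "0 \<le> (SUP x\<in>closure tetrablock. cmod (eval_poly3 p x))"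
  using distinguished_boundary_in_closure[of 0 1]
  by (intro order_trans[OF norm_ge_zero cmod_eval_poly3_le_Sup]) simp

lemma tetrablock_von_neumann:
  "norm (op_poly3 p Tet1 Tet2 Tet3 f) \<le> (SUP x\<in>closure tetrablock. cmod (eval_poly3 p x)) * norm f"
proof (rule norm_le_of_cosymbol_bound[OF has_cosymbol_op_poly3[OF cosymbol_Tet1 cosymbol_Tet2 cosymbol_Tet3]])
  show "0 \<le> (SUP x\<in>closure tetrablock. cmod (eval_poly3 p x))"
    by (rule Sup_cmod_eval_poly3_nonneg)
  fix u :: complex and x :: 'e assume u: "cmod u = 1"
  show "norm (op_poly3 p (\<lambda>x. A1 x + u *\<^sub>C adj A2 x) (pencil u) (\<lambda>x. u *\<^sub>C x) x)
      \<le> (SUP x\<in>closure tetrablock. cmod (eval_poly3 p x)) * norm x"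
    unfolding symbol_Tet1[OF u] by (rule norm_op_poly3_normal_le[of "pencil u" "copencil u", OF bounded_pencil adjoint_pair_pencil pencil_normal[OF u] pencil_form[OF u] u])
qed

lemma norm_Tet1_le: "norm (Tet1 f) \<le> norm f"
proof -
  have "norm (A1 x + u *\<^sub>C adj A2 x) \<le> 1 * norm x" if "cmod u = 1" for u x
    unfolding symbol_Tet1[OF that] using norm_copencil_le[OF that] that by (simp add: norm_scaleC)
  from norm_le_of_cosymbol_bound[OF cosymbol_Tet1 _ this] show ?thesis by simp
qed

text \<open>On symbols this is \<open>norm_blaschke_factor_le\<close> with \<open>a = z u\<close>, but an inequality between two
  coanalytic Toeplitz operators cannot be read off pointwise from their symbols.  It can once the left side is
  written as one operator applied to \<open>f = (1 - z T1) h\<close>: the operator \<open>(T2 - z T3) (1 - z T1)\<^sup>-\<^sup>1\<close>,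
  whose Neumann partial sums \<open>V (\<Sum>k<m. X\<^sup>k)\<close> have polynomial symbols of norm at most \<open>1 + |z|\<^sup>m\<close>.\<close>

lemma resolvent_contraction:
  assumes z: "cmod z < 1"
  shows "norm (Tet2 h - z *\<^sub>C Tet3 h) \<le> norm (h - z *\<^sub>C Tet1 h)"
proof -
  define X where "X f = z *\<^sub>C Tet1 f" for f
  define Y where "Y u x = z *\<^sub>C (A1 x + u *\<^sub>C adj A2 x)" for u x
  define V where "V f = Tet2 f - z *\<^sub>C Tet3 f" for f
  have X: "bounded_clinear X" unfolding X_def[abs_def] by (intro bounded_clinear_scaled bounded_Tet1)
  have V: "bounded_clinear V"
    unfolding V_def[abs_def] by (intro bounded_clinear_minus bounded_clinear_scaled bounded_Tet2 bounded_Tet3)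
  have cX: "has_cosymbol X Y"
    unfolding X_def[abs_def] Y_def[abs_def] by (rule has_cosymbol_scaled[OF cosymbol_Tet1])
  have cV: "has_cosymbol V (\<lambda>u x. pencil u x - z *\<^sub>C u *\<^sub>C x)"
    unfolding V_def[abs_def]
    by (rule has_cosymbol_diff[OF cosymbol_Tet2 has_cosymbol_scaled[OF cosymbol_Tet3]])
  have Xn: "norm (X f) \<le> cmod z * norm f" for f
    using norm_Tet1_le[of f] by (simp add: X_def norm_scaleC mult_left_mono)
  obtain K where K: "K > 0" "\<And>f. norm (V f) \<le> K * norm f"
    using V by (rule bounded_clinear_boundedE) blast
  have partial: "norm (V (\<Sum>k<m. (X ^^ k) f)) \<le> (1 + cmod z ^ m) * norm f" for m f
  proof (rule norm_le_of_cosymbol_bound[OF has_cosymbol_compose[OF cV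
          has_cosymbol_sum[OF has_cosymbol_funpow[OF cX]]]])
    fix u :: complex and x assume u: "cmod u = 1"
    define y where "y = (\<Sum>k<m. (Y u ^^ k) x)"
    have Yu: "bounded_clinear (Y u)"
      unfolding Y_def[abs_def] by (intro bounded_clinear_scaled bounded_clinear_plus A1 bounded_adj_A2)
    have Y_eq: "Y u x = (z * u) *\<^sub>C copencil u x" for x
      by (simp add: Y_def symbol_Tet1[OF u] scaleC_scaleC)
    have Yn: "norm (Y u x) \<le> cmod z * norm x" for x
      using norm_copencil_le[OF u, of x] u by (simp add: Y_eq norm_scaleC norm_mult mult_left_mono)
    have "norm (pencil u y - z *\<^sub>C u *\<^sub>C y) \<le> norm (y - Y u y)"
      using norm_blaschke_factor_le[of "pencil u" "copencil u" "z * u" y, OF bounded_pencil adjoint_pair_pencil pencil_normal[OF u] pencil_form[OF u]] z u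
      by (simp add: scaleC_scaleC Y_eq norm_mult)
    also have "y - Y u y = x - (Y u ^^ m) x" unfolding y_def by (rule sum_funpow_telescope(1)[OF Yu])
    also have "norm \<dots> \<le> norm x + cmod z ^ m * norm x"
      using norm_triangle_ineq4[of x "(Y u ^^ m) x"] norm_funpow_le[OF Yn, of m x] by simp
    finally show "norm (pencil u (\<Sum>k<m. (Y u ^^ k) x) - z *\<^sub>C u *\<^sub>C (\<Sum>k<m. (Y u ^^ k) x))
        \<le> (1 + cmod z ^ m) * norm x"
      by (simp add: y_def distrib_right)
  qed simp
  have "norm (V h) \<le> (1 + cmod z ^ m) * norm (h - X h) + K * (cmod z ^ m * norm h)" for m
  proof -
    have "V h = V (\<Sum>k<m. (X ^^ k) (h - X h)) + V ((X ^^ m) h)"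
      unfolding sum_funpow_telescope(2)[OF X] by (simp add: bounded_clinear_diff[OF V])
    also have "norm \<dots> \<le> norm (V (\<Sum>k<m. (X ^^ k) (h - X h))) + norm (V ((X ^^ m) h))"
      by (rule norm_triangle_ineq)
    also have "norm (V ((X ^^ m) h)) \<le> K * (cmod z ^ m * norm h)"
      using norm_funpow_le[OF Xn norm_ge_zero, of m h] K
      by (intro order_trans[OF K(2)] mult_left_mono) auto
    finally show ?thesis using partial[where m = m and f = "h - X h"] by simp
  qed
  moreover have "(\<lambda>m. (1 + cmod z ^ m) * norm (h - X h) + K * (cmod z ^ m * norm h))
      \<longlonglongrightarrow> (1 + 0) * norm (h - X h) + K * (0 * norm h)"
    by (intro tendsto_intros LIMSEQ_power_zero) (use z in auto)
  ultimately have "norm (V h) \<le> (1 + 0) * norm (h - X h) + K * (0 * norm h)"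
    by (intro LIMSEQ_le_const) auto
  then show ?thesis by (simp add: V_def X_def)
qed

text \<open>The factorisation \<open>(1 - w C) (1 - z T1)\<close> with \<open>C = (T2 - z T3) (1 - z T1)\<^sup>-\<^sup>1\<close>, both factors
  being perturbations of the identity by strict contractions.\<close>

lemma bij_tetrablock_pencil:
  assumes z: "cmod z < 1" and w: "cmod w < 1"
  shows "bij (\<lambda>f. f - z *\<^sub>C Tet1 f - w *\<^sub>C Tet2 f + (z * w) *\<^sub>C Tet3 f)"
proof -
  define E where "E f = f - z *\<^sub>C Tet1 f" for f
  have E: "bij E"
    unfolding E_def[abs_def]
  proof (rule bij_identity_minus_contraction)
    show "norm (z *\<^sub>C Tet1 f) \<le> cmod z * norm f" for f
      using norm_Tet1_le[of f] by (simp add: norm_scaleC mult_left_mono)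
  qed (simp_all add: bounded_clinear_diff[OF bounded_Tet1] scaleC_diff_right z)
  define R where "R = inv E"
  have ER: "E (R h) = h" and RE: "R (E h) = h" for h
    using E by (simp_all add: R_def bij_is_surj surj_f_inv_f bij_is_inj inv_f_f)
  have Ediff: "E (f - g) = E f - E g" for f g
    by (simp add: E_def bounded_clinear_diff[OF bounded_Tet1] scaleC_diff_right)
  have Rdiff: "R (f - g) = R f - R g" for f g
    by (metis ER RE Ediff)
  define X where "X h = w *\<^sub>C (Tet2 (R h) - z *\<^sub>C Tet3 (R h))" for h
  have "bij (\<lambda>h. h - X h)"
  proof (rule bij_identity_minus_contraction)
    show "X (f - g) = X f - X g" for f g
      by (simp add: X_def Rdiff bounded_clinear_diff[OF bounded_Tet2] bounded_clinear_diff[OF bounded_Tet3]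
          scaleC_simps algebra_simps)
    show "norm (X h) \<le> cmod w * norm h" for h
      using resolvent_contraction[OF z, of "R h"] ER[of h]
      by (simp add: X_def norm_scaleC E_def mult_left_mono)
  qed (simp_all add: w)
  then have "bij ((\<lambda>h. h - X h) \<circ> E)" using E by (intro bij_comp)
  moreover have "(\<lambda>h. h - X h) \<circ> E = (\<lambda>f. f - z *\<^sub>C Tet1 f - w *\<^sub>C Tet2 f + (z * w) *\<^sub>C Tet3 f)"
    by (simp add: fun_eq_iff X_def RE) (simp add: E_def scaleC_simps mult.commute algebra_simps)
  ultimately show ?thesis by simp
qed

text \<open>Outside the closed tetrablock the defining polynomial vanishes at \<open>(l1, l2, l3)\<close> for some \<open>z\<close>, \<open>w\<close> in the
  open disc, and then it turns into a combination of the \<open>Ti - li\<close> on substituting the operators.\<close>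

lemma taylor_spectrum_subset: "taylor_spectrum Tet1 Tet2 Tet3 \<subseteq> closure tetrablock"
proof (rule subsetI, rule ccontr)
  fix l assume l: "l \<in> taylor_spectrum Tet1 Tet2 Tet3" "l \<notin> closure tetrablock"
  obtain l1 l2 l3 where l_eq: "l = (l1, l2, l3)" by (cases l)
  then obtain z w where zw: "cmod z < 1" "cmod w < 1" and 0: "1 - z * l1 - w * l2 + z * w * l3 = 0"
    using closure_tetrablockI l(2) by blast
  have comm: "Tet1 (Tet2 x) = Tet2 (Tet1 x)" "Tet1 (Tet3 x) = Tet3 (Tet1 x)" "Tet2 (Tet3 x) = Tet3 (Tet2 x)" for x
    using Tet12_commute Tet13_commute Tet23_commute by (simp_all add: fun_eq_iff)
  let ?U1 = "\<lambda>x. Tet1 x - l1 *\<^sub>C x" and ?U2 = "\<lambda>x. Tet2 x - l2 *\<^sub>C x" and ?U3 = "\<lambda>x. Tet3 x - l3 *\<^sub>C x"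
  have "(- z) *\<^sub>C ?U1 x + (- w) *\<^sub>C ?U2 x + (z * w) *\<^sub>C ?U3 x
      = x - z *\<^sub>C Tet1 x - w *\<^sub>C Tet2 x + (z * w) *\<^sub>C Tet3 x" for x
  proof -
    have "(- z) *\<^sub>C ?U1 x + (- w) *\<^sub>C ?U2 x + (z * w) *\<^sub>C ?U3 x
      = x - z *\<^sub>C Tet1 x - w *\<^sub>C Tet2 x + (z * w) *\<^sub>C Tet3 x - (1 - z * l1 - w * l2 + z * w * l3) *\<^sub>C x"
      by (simp add: scaleC_simps algebra_simps)
    then show ?thesis by (simp add: 0 scaleC_zero_left)
  qed
  then have "koszul_exact ?U1 ?U2 ?U3"
    using bij_tetrablock_pencil[OF zw]
    by (intro koszul_exact_of_bij_combination[of _ _ _ "- z" "- w" "z * w"] bounded_clinear_minus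
        bounded_clinear_scaled bounded_clinear_id bounded_Tet1 bounded_Tet2 bounded_Tet3)
       (simp_all add: bounded_clinear_simps[OF bounded_Tet1] bounded_clinear_simps[OF bounded_Tet2]
          bounded_clinear_simps[OF bounded_Tet3] scaleC_simps comm mult.commute algebra_simps)
  then show False using l(1) by (simp add: l_eq taylor_spectrum_def)
qed

lemma tetrablock_contraction_Tet: "tetrablock_contraction Tet1 Tet2 Tet3"
  unfolding tetrablock_contraction_def
  using bounded_Tet1 bounded_Tet2 bounded_Tet3 Tet12_commute Tet13_commute Tet23_commute taylor_spectrum_subset 
    onorm_bound[OF Sup_cmod_eval_poly3_nonneg tetrablock_von_neumann]
  by blast

lemma adj_Tet1: "adj Tet1 = analytic_toeplitz (adj A1) A2" and adj_Tet2: "adj Tet2 = analytic_toeplitz (adj A2) A1"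
  by (intro adj_eqI adjoint_pair_toeplitz A1 A2 bounded_adj_A1 bounded_adj_A2 adjoint_pair_A1 adjoint_pair_A2 adjoint_pair_sym[OF adjoint_pair_A1]
      adjoint_pair_sym[OF adjoint_pair_A2])+

lemma fundamental_operators_Tet:
  "fundamental_operators Tet1 Tet2 Tet3 (\<lambda>f. hardy_const (A1 (hardy_coeff f 0)))
     (\<lambda>f. hardy_const (A2 (hardy_coeff f 0)))"
  unfolding fundamental_operators_def defect_space_backward_shift defect_op_backward_shift
proof (intro conjI allI bounded_op_on_constants A1 A2 hardy_eqI)
  fix f n
  show "hardy_coeff (Tet1 f - adj Tet2 (Tet3 f)) n
      = hardy_coeff (const_proj (hardy_const (A1 (hardy_coeff (const_proj f) 0)))) n"
    by (cases n) (simp_all add: adj_Tet2 coeff_analytic_toeplitz[OF bounded_adj_A2 A1] hardy_coeff_diff coeff_Tet1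
        coeff_backward_shift const_proj_def coeff_hardy_const bounded_clinear_zero[OF A1])
  show "hardy_coeff (Tet2 f - adj Tet1 (Tet3 f)) n
      = hardy_coeff (const_proj (hardy_const (A2 (hardy_coeff (const_proj f) 0)))) n"
    by (cases n) (simp_all add: adj_Tet1 coeff_analytic_toeplitz[OF bounded_adj_A1 A2] hardy_coeff_diff coeff_Tet2
        coeff_backward_shift const_proj_def coeff_hardy_const bounded_clinear_zero[OF A2])
qed

end

theorem corollary3p7:
  fixes A1 A2 :: "'e::chilbert_space \<Rightarrow> 'e"
  assumes "bounded_clinear A1" and "bounded_clinear A2"
    and "A1 \<circ> A2 = A2 \<circ> A1"
    and "commutator (adj A1) A1 = commutator (adj A2) A2"
    and "\<And>z. cmod z = 1 \<Longrightarrow> numerical_radius (\<lambda>x. A1 x + z *\<^sub>C A2 x) \<le> 1"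
  shows "\<exists>(T1 :: 'e hardy \<Rightarrow> 'e hardy) T2 T3 F1 F2 (U :: 'e hardy \<Rightarrow> 'e).
           tetrablock_contraction T1 T2 T3 \<and>
           fundamental_operators T1 T2 T3 F1 F2 \<and>
           unitary_from (defect_space T3) U \<and>
           (\<forall>x\<in>defect_space T3. U (F1 x) = A1 (U x) \<and> U (F2 x) = A2 (U x))"
proof (intro exI conjI)
  show "tetrablock_contraction (coanalytic_toeplitz A1 (adj A2)) (coanalytic_toeplitz A2 (adj A1))
      (backward_shift :: 'e hardy \<Rightarrow> 'e hardy)"
    by (rule tetrablock_contraction_Tet[OF assms])
  show "fundamental_operators (coanalytic_toeplitz A1 (adj A2)) (coanalytic_toeplitz A2 (adj A1))
      (backward_shift :: 'e hardy \<Rightarrow> 'e hardy)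
      (\<lambda>f. hardy_const (A1 (hardy_coeff f 0))) (\<lambda>f. hardy_const (A2 (hardy_coeff f 0)))"
    by (rule fundamental_operators_Tet[OF assms])
  show "unitary_from (defect_space (backward_shift :: 'e hardy \<Rightarrow> 'e hardy)) (\<lambda>f. hardy_coeff f 0)"
    unfolding defect_space_backward_shift by (rule unitary_from_constants)
qed (simp add: coeff_hardy_const)

end
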